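(* Let $E\to P$ be a Courant algebroid, with $\mathcal{A}=C^\infty(P)$, $\mathcal{E}=\Gamma(E)$, bracket $[\![\cdot,\cdot]\!]$, bilinear form $\langle\cdot,\cdot\rangle$ and operator $\mathcal{D}:\mathcal{A}\to\mathcal{E}$, and let $(\mathcal{E},\cdot)$ be the Leibniz algebra with product $x\cdot y=[\![x,y]\!]+\mathcal{D}\langle x,y\rangle$. Then $\mathcal{D}(\mathcal{A})$ is a two-sided ideal of $(\mathcal{E},\cdot)$ which contains all squares $x\cdot x$ and is contained in the kernel of $\lambda$, so that $\mathfrak{h}=\mathcal{E}/\mathcal{D}(\mathcal{A})$ is a Lie algebra (with bracket induced by $\cdot$) acting on $\mathcal{E}$ by left multiplication; and, with $q:\mathcal{E}\to\mathcal{E}/\mathcal{D}(\mathcal{A})$ the quotient map, $(\mathfrak{g},\mathfrak{h},q)$ with $\mathfrak{g}=\mathcal{E}/\mathcal{D}(\mathcal{A})\ltimes\mathcal{E}$ is an enveloping Lie algebra of $(\mathcal{E},\cdot)$. Moreover, the Courant algebroid bracket on $\mathcal{E}$ is obtained from the Lie bracket on $\mathfrak{g}$ by identifying $\mathcal{E}$ with the graph $\{(\tfrac12 q(x),x):x\in\mathcal{E}\}$ of $\tfrac12 q$ and projecting along the subalgebra $\mathcal{E}/\mathcal{D}(\mathcal{A})\times\{0\}$; that is, for all $x,y\in\mathcal{E}$, $[\![x,y]\!]$ is the second component of $[(\tfrac12q(x),x),(\tfrac12q(y),y)]\in\mathfrak{g}$.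
   Context: A Courant algebroid is a smooth vector bundle $E\to P$ over a manifold $P$ with a nondegenerate symmetric bilinear form $\langle\cdot,\cdot\rangle$ on the bundle, a skew-symmetric bilinear bracket $[\![\cdot,\cdot]\!]$ on $\mathcal{E}=\Gamma(E)$ (smooth sections), and a bundle map $\rho:E\to TP$ such that for all $x,y,z\in\mathcal{E}$ and $f,g\in\mathcal{A}=C^\infty(P)$: (1) $\sum_{(x,y,z)}[\![[\![x,y]\!],z]\!]=\mathcal{D}T(x,y,z)$; (2) $\rho[\![x,y]\!]=[\rho x,\rho y]$; (3) $[\![x,fy]\!]=f[\![x,y]\!]+(\rho(x)f)y-\langle x,y\rangle\mathcal{D}f$; (4) $\rho\circ\mathcal{D}=0$, i.e. $\langle\mathcal{D}f,\mathcal{D}g\rangle=0$ for all $f,g$; (5) $\rho(x)\langle y,z\rangle=\langle[\![x,y]\!]+\mathcal{D}\langle x,y\rangle,z\rangle+\langle y,[\![x,z]\!]+\mathcal{D}\langle x,z\rangle\rangle$. Here $\sum_{(x,y,z)}$ is the sum over cyclic permutations, $T(x,y,z)=\frac13\sum_{(x,y,z)}\langle[\![x,y]\!],z\rangle$, and $\mathcal{D}:\mathcal{A}\to\mathcal{E}$ is determined by $\langle\mathcal{D}f,x\rangle=\frac12\rho(x)f$ for all $x\in\mathcal{E}$. A (left) Leibniz algebra is a vector space $\mathcal{E}$ with a bilinear operation satisfying $x\cdot(y\cdot z)=(x\cdot y)\cdot z+y\cdot(x\cdot z)$. It is a known fact that $x\cdot y=[\![x,y]\!]+\mathcal{D}\langle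 x,y\rangle$ makes $\Gamma(E)$ a real Leibniz algebra. $\lambda(x)$ denotes left multiplication $y\mapsto x\cdot y$, and $\mathrm{Der}(\mathcal{E})$ the Lie algebra of derivations of $(\mathcal{E},\cdot)$. Enveloping Lie algebra: let $\mathfrak{h}$ be a Lie algebra with a derivation action on $\mathcal{E}$, i.e. a Lie algebra homomorphism $\mathfrak{h}\to\mathrm{Der}(\mathcal{E})$, written $(\xi,x)\mapsto\xi x$, and let $f:\mathcal{E}\to\mathfrak{h}$ be a linear map such that $[\xi,f(x)]=f(\xi x)$ and $f(x)y=x\cdot y$ for all $\xi\in\mathfrak{h}$, $x,y\in\mathcal{E}$. Let $\mathfrak{g}=\mathfrak{h}\ltimes\mathcal{E}$ be the semidirect product Lie algebra, with $\mathcal{E}$ regarded as abelian: $[(\xi,x),(\eta,y)]=([\xi,\eta],\xi y-\eta x)$. Then $(\mathfrak{g},\mathfrak{h},f)$ is called an enveloping Lie algebra of $(\mathcal{E},\cdot)$. *)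

theory Defs
  imports "HOL-Analysis.Analysis" "HOL-Algebra.Module" "HOL-Algebra.QuotRing"
begin

section \<open>Smooth manifolds\<close>

text \<open>
  The model space \<open>\<real>\<^sup>n\<close> is a type of class \<^class>\<open>real_inner\<close> that is finite-dimensional in the sense
  below.  Unlike \<^class>\<open>euclidean_space\<close>, this admits dimension 0 (and, for the typical fibre of
  a vector bundle, rank 0).
\<close>

definition finite_dimensional :: "'a::real_vector itself \<Rightarrow> bool" where
  "finite_dimensional _ \<longleftrightarrow> (\<exists>B :: 'a set. finite B \<and> span B = UNIV)"

text \<open>On a finite-dimensional domain, \<open>C\<^sup>k\<close> can be tested on directional derivatives.\<close>

primrec Ck_on :: "nat \<Rightarrow> 'a::real_normed_vector set \<Rightarrow> ('a \<Rightarrow> 'b::real_normed_vector) \<Rightarrow> bool" where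
  "Ck_on 0 U f \<longleftrightarrow> continuous_on U f"
| "Ck_on (Suc k) U f \<longleftrightarrow>
     (\<forall>x\<in>U. f differentiable (at x)) \<and>
     (\<forall>v. Ck_on k U (\<lambda>x. frechet_derivative f (at x) v))"

definition smooth_on :: "'a::real_normed_vector set \<Rightarrow> ('a \<Rightarrow> 'b::real_normed_vector) \<Rightarrow> bool" where
  "smooth_on U f \<longleftrightarrow> (\<forall>k. Ck_on k U f)"

text \<open>
  A chart is a domain together with a coordinate map, whose values off the domain are irrelevant.
  A manifold is a Hausdorff, second countable space (type classes, below) with a smooth atlas; the
  atlas need not be maximal, as all notions below agree for compatible atlases.
\<close>

type_synonym ('p, 'm) chart = "'p set \<times> ('p \<Rightarrow> 'm)"

definition chart_inv :: "('p, 'm) chart \<Rightarrow> 'm \<Rightarrow> 'p" where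
  "chart_inv c = inv_into (fst c) (snd c)"

definition smooth_manifold ::
  "('p::{t2_space, second_countable_topology}, 'm::real_inner) chart set \<Rightarrow> bool" where
  "smooth_manifold \<A> \<longleftrightarrow>
     finite_dimensional TYPE('m) \<and>
     (\<Union>c\<in>\<A>. fst c) = UNIV \<and>
     (\<forall>c\<in>\<A>. open (fst c) \<and> open (snd c ` fst c) \<and>
        homeomorphism (fst c) (snd c ` fst c) (snd c) (chart_inv c)) \<and>
     (\<forall>c\<in>\<A>. \<forall>d\<in>\<A>. smooth_on (snd c ` (fst c \<inter> fst d)) (snd d \<circ> chart_inv c))"

text \<open>Smoothness on an open set \<open>W\<close> of the manifold, and the algebra \<open>C\<^sup>\<infinity>(P)\<close>.\<close>

definition smooth_fun_on ::
  "('p, 'm::real_inner) chart set \<Rightarrow> 'p set \<Rightarrow> ('p \<Rightarrow> 'b::real_normed_vector) \<Rightarrow> bool" where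
  "smooth_fun_on \<A> W f \<longleftrightarrow> (\<forall>c\<in>\<A>. smooth_on (snd c ` (fst c \<inter> W)) (f \<circ> chart_inv c))"

definition smooth_functions :: "('p, 'm::real_inner) chart set \<Rightarrow> ('p \<Rightarrow> real) set" where
  "smooth_functions \<A> = {f. smooth_fun_on \<A> UNIV f}"

text \<open>
  A tangent vector at \<open>p\<close> is given by its coordinates in every chart around \<open>p\<close>, which transform
  by the derivatives of the coordinate changes.  (It is 0 at all other pairs, so that equality is
  equality of functions and the vector space operations are pointwise.)
\<close>

type_synonym ('p, 'm) tangent_vector = "('p, 'm) chart \<Rightarrow> 'm"

definition tangent_space ::
  "('p, 'm::real_inner) chart set \<Rightarrow> 'p \<Rightarrow> ('p, 'm) tangent_vector set" where
  "tangent_space \<A> p = {v.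
     (\<forall>c. c \<notin> \<A> \<or> p \<notin> fst c \<longrightarrow> v c = 0) \<and>
     (\<forall>c\<in>\<A>. \<forall>d\<in>\<A>. p \<in> fst c \<inter> fst d \<longrightarrow>
        v d = frechet_derivative (snd d \<circ> chart_inv c) (at (snd c p)) (v c))}"

text \<open>The derivative of \<open>f\<close> along a tangent vector; it does not depend on the chosen chart.\<close>

definition tangent_apply ::
  "('p, 'm::real_inner) chart set \<Rightarrow> 'p \<Rightarrow> ('p, 'm) tangent_vector \<Rightarrow> ('p \<Rightarrow> real) \<Rightarrow> real" where
  "tangent_apply \<A> p v f =
     (let c = (SOME c. c \<in> \<A> \<and> p \<in> fst c)
      in frechet_derivative (f \<circ> chart_inv c) (at (snd c p)) (v c))"

definition vector_field_apply ::
  "('p, 'm::real_inner) chart set \<Rightarrow> ('p \<Rightarrow> ('p, 'm) tangent_vector) \<Rightarrow> ('p \<Rightarrow> real) \<Rightarrow> 'p \<Rightarrow> real" where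
  "vector_field_apply \<A> X f = (\<lambda>p. tangent_apply \<A> p (X p) f)"

text \<open>The Lie bracket of vector fields is the commutator of the derivations of \<open>C\<^sup>\<infinity>(P)\<close>.\<close>

definition is_vector_field_bracket ::
  "('p, 'm::real_inner) chart set \<Rightarrow> ('p \<Rightarrow> ('p, 'm) tangent_vector) \<Rightarrow>
   ('p \<Rightarrow> ('p, 'm) tangent_vector) \<Rightarrow> ('p \<Rightarrow> ('p, 'm) tangent_vector) \<Rightarrow> bool" where
  "is_vector_field_bracket \<A> X Y Z \<longleftrightarrow>
     (\<forall>f\<in>smooth_functions \<A>. \<forall>p.
        vector_field_apply \<A> Z f p =
          vector_field_apply \<A> X (vector_field_apply \<A> Y f) p
          - vector_field_apply \<A> Y (vector_field_apply \<A> X f) p)"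


section \<open>Smooth vector bundles\<close>

text \<open>
  A vector bundle is a family of vector spaces \<open>fib p\<close> with smoothly compatible local
  trivializations \<open>(V, \<Phi>)\<close>, \<open>\<Phi> p : fib p \<rightarrow> 'f\<close> for \<open>p \<in> V\<close>; these determine the topology and smooth
  structure of the total space \<open>\<Union>p. {p} \<times> fib p\<close>.  Taking the fibres to be subspaces of one
  arbitrary (possibly infinite-dimensional) vector space \<open>'e\<close> is no restriction: use the
  direct sum of all fibres.
\<close>

type_synonym ('p, 'e, 'f) trivialization = "'p set \<times> ('p \<Rightarrow> 'e \<Rightarrow> 'f)"

text \<open>The inverse of a trivialization at \<open>p\<close>, applied to \<open>w\<close>; as \<open>p\<close> varies, a local frame section.\<close>

definition triv_inv :: "('p \<Rightarrow> 'e set) \<Rightarrow> ('p, 'e, 'f) trivialization \<Rightarrow> 'p \<Rightarrow> 'f \<Rightarrow> 'e" where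
  "triv_inv fib t p = inv_into (fib p) (snd t p)"

definition smooth_vector_bundle ::
  "('p::{t2_space, second_countable_topology}, 'm::real_inner) chart set \<Rightarrow>
   ('p \<Rightarrow> 'e::real_vector set) \<Rightarrow> ('p, 'e, 'f::real_inner) trivialization set \<Rightarrow> bool" where
  "smooth_vector_bundle \<A> fib \<T> \<longleftrightarrow>
     finite_dimensional TYPE('f) \<and>
     (\<forall>p. subspace (fib p)) \<and>
     (\<Union>t\<in>\<T>. fst t) = UNIV \<and>
     (\<forall>t\<in>\<T>. open (fst t) \<and>
        (\<forall>p\<in>fst t.
           bij_betw (snd t p) (fib p) UNIV \<and>
           (\<forall>a\<in>fib p. \<forall>b\<in>fib p. snd t p (a + b) = snd t p a + snd t p b) \<and>
           (\<forall>r. \<forall>a\<in>fib p. snd t p (r *\<^sub>R a) = r *\<^sub>R snd t p a))) \<and>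
     (\<forall>t\<in>\<T>. \<forall>u\<in>\<T>. \<forall>w. smooth_fun_on \<A> (fst t \<inter> fst u) (\<lambda>p. snd u p (triv_inv fib t p w)))"

definition sections ::
  "('p, 'm::real_inner) chart set \<Rightarrow> ('p \<Rightarrow> 'e::real_vector set) \<Rightarrow>
   ('p, 'e, 'f::real_inner) trivialization set \<Rightarrow> ('p \<Rightarrow> 'e) set" where
  "sections \<A> fib \<T> =
     {s. (\<forall>p. s p \<in> fib p) \<and> (\<forall>t\<in>\<T>. smooth_fun_on \<A> (fst t) (\<lambda>p. snd t p (s p)))}"

definition nondegenerate_symmetric_form ::
  "('p, 'm::real_inner) chart set \<Rightarrow> ('p \<Rightarrow> 'e::real_vector set) \<Rightarrow>
   ('p, 'e, 'f::real_inner) trivialization set \<Rightarrow> ('p \<Rightarrow> 'e \<Rightarrow> 'e \<Rightarrow> real) \<Rightarrow> bool" where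
  "nondegenerate_symmetric_form \<A> fib \<T> form \<longleftrightarrow>
     (\<forall>p. \<forall>a\<in>fib p. \<forall>b\<in>fib p. form p a b = form p b a) \<and>
     (\<forall>p. \<forall>a\<in>fib p. \<forall>b\<in>fib p. \<forall>d\<in>fib p. form p (a + b) d = form p a d + form p b d) \<and>
     (\<forall>p r. \<forall>a\<in>fib p. \<forall>b\<in>fib p. form p (r *\<^sub>R a) b = r * form p a b) \<and>
     (\<forall>p. \<forall>a\<in>fib p. (\<forall>b\<in>fib p. form p a b = 0) \<longrightarrow> a = 0) \<and>
     (\<forall>t\<in>\<T>. \<forall>w w'.
        smooth_fun_on \<A> (fst t) (\<lambda>p. form p (triv_inv fib t p w) (triv_inv fib t p w')))"

text \<open>
  Smooth bundle maps \<open>E \<rightarrow> TP\<close> over the identity, where \<open>TP\<close> is trivialized over the domain of a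
  chart \<open>c\<close> by \<open>v \<mapsto> v c\<close>.
\<close>

definition bundle_map_to_tangent ::
  "('p, 'm::real_inner) chart set \<Rightarrow> ('p \<Rightarrow> 'e::real_vector set) \<Rightarrow>
   ('p, 'e, 'f::real_inner) trivialization set \<Rightarrow> ('p \<Rightarrow> 'e \<Rightarrow> ('p, 'm) tangent_vector) \<Rightarrow> bool" where
  "bundle_map_to_tangent \<A> fib \<T> \<rho> \<longleftrightarrow>
     (\<forall>p. \<forall>a\<in>fib p. \<rho> p a \<in> tangent_space \<A> p) \<and>
     (\<forall>p. \<forall>a\<in>fib p. \<forall>b\<in>fib p. \<rho> p (a + b) = (\<lambda>c. \<rho> p a c + \<rho> p b c)) \<and>
     (\<forall>p r. \<forall>a\<in>fib p. \<rho> p (r *\<^sub>R a) = (\<lambda>c. r *\<^sub>R \<rho> p a c)) \<and>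
     (\<forall>t\<in>\<T>. \<forall>c\<in>\<A>. \<forall>w. smooth_fun_on \<A> (fst t \<inter> fst c) (\<lambda>p. \<rho> p (triv_inv fib t p w) c))"


section \<open>Courant algebroids\<close>

text \<open>
  \<open>\<D>\<close> is listed among the data and pinned down by \<open>D_eq\<close>; by nondegeneracy there is exactly one
  such operator on \<open>C\<^sup>\<infinity>(P)\<close>.  The values of \<open>br\<close> and \<open>\<D>\<close> outside \<open>\<Gamma>(E)\<close> and \<open>C\<^sup>\<infinity>(P)\<close> are irrelevant.
\<close>

locale courant_data =
  fixes \<A> :: "('p::{t2_space, second_countable_topology}, 'm::real_inner) chart set"
    and fib :: "'p \<Rightarrow> 'e::real_vector set"
    and \<T> :: "('p, 'e, 'f::real_inner) trivialization set"
    and form :: "'p \<Rightarrow> 'e \<Rightarrow> 'e \<Rightarrow> real"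
    and br :: "('p \<Rightarrow> 'e) \<Rightarrow> ('p \<Rightarrow> 'e) \<Rightarrow> ('p \<Rightarrow> 'e)"
    and \<rho> :: "'p \<Rightarrow> 'e \<Rightarrow> ('p, 'm) tangent_vector"
    and \<D> :: "('p \<Rightarrow> real) \<Rightarrow> ('p \<Rightarrow> 'e)"
begin

abbreviation \<Gamma> :: "('p \<Rightarrow> 'e) set" where
  "\<Gamma> \<equiv> sections \<A> fib \<T>"

abbreviation pair :: "('p \<Rightarrow> 'e) \<Rightarrow> ('p \<Rightarrow> 'e) \<Rightarrow> 'p \<Rightarrow> real" where
  "pair x y \<equiv> (\<lambda>p. form p (x p) (y p))"

abbreviation act :: "('p \<Rightarrow> 'e) \<Rightarrow> ('p \<Rightarrow> real) \<Rightarrow> 'p \<Rightarrow> real" where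
  "act x f \<equiv> vector_field_apply \<A> (\<lambda>p. \<rho> p (x p)) f"

abbreviation T :: "('p \<Rightarrow> 'e) \<Rightarrow> ('p \<Rightarrow> 'e) \<Rightarrow> ('p \<Rightarrow> 'e) \<Rightarrow> 'p \<Rightarrow> real" where
  "T x y z \<equiv> (\<lambda>p. 1/3 * (pair (br x y) z p + pair (br y z) x p + pair (br z x) y p))"

end

locale courant_algebroid = courant_data +
  assumes manifold: "smooth_manifold \<A>"
    and vector_bundle: "smooth_vector_bundle \<A> fib \<T>"
    and form: "nondegenerate_symmetric_form \<A> fib \<T> form"
    and anchor: "bundle_map_to_tangent \<A> fib \<T> \<rho>"
    and br_closed: "\<And>x y. x \<in> \<Gamma> \<Longrightarrow> y \<in> \<Gamma> \<Longrightarrow> br x y \<in> \<Gamma>"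
    and br_add: "\<And>x y z. x \<in> \<Gamma> \<Longrightarrow> y \<in> \<Gamma> \<Longrightarrow> z \<in> \<Gamma> \<Longrightarrow>
          br (\<lambda>p. x p + y p) z = (\<lambda>p. br x z p + br y z p)"
    and br_scale: "\<And>r x y. x \<in> \<Gamma> \<Longrightarrow> y \<in> \<Gamma> \<Longrightarrow> br (\<lambda>p. r *\<^sub>R x p) y = (\<lambda>p. r *\<^sub>R br x y p)"
    and br_skew: "\<And>x y. x \<in> \<Gamma> \<Longrightarrow> y \<in> \<Gamma> \<Longrightarrow> br x y = (\<lambda>p. - br y x p)"
    and D_closed: "\<And>f. f \<in> smooth_functions \<A> \<Longrightarrow> \<D> f \<in> \<Gamma>"
    and D_eq: "\<And>f x p. f \<in> smooth_functions \<A> \<Longrightarrow> x \<in> \<Gamma> \<Longrightarrow> pair (\<D> f) x p = 1/2 * act x f p"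
    and jacobi: "\<And>x y z p. x \<in> \<Gamma> \<Longrightarrow> y \<in> \<Gamma> \<Longrightarrow> z \<in> \<Gamma> \<Longrightarrow>
          br (br x y) z p + br (br y z) x p + br (br z x) y p =
          \<D> (T x y z) p"
    and anchor_br: "\<And>x y. x \<in> \<Gamma> \<Longrightarrow> y \<in> \<Gamma> \<Longrightarrow>
          is_vector_field_bracket \<A> (\<lambda>p. \<rho> p (x p)) (\<lambda>p. \<rho> p (y p)) (\<lambda>p. \<rho> p (br x y p))"
    and br_leibniz: "\<And>x y f p. x \<in> \<Gamma> \<Longrightarrow> y \<in> \<Gamma> \<Longrightarrow> f \<in> smooth_functions \<A> \<Longrightarrow>
          br x (\<lambda>p. f p *\<^sub>R y p) p = f p *\<^sub>R br x y p + act x f p *\<^sub>R y p - pair x y p *\<^sub>R \<D> f p"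
    and anchor_D: "\<And>f p. f \<in> smooth_functions \<A> \<Longrightarrow> \<rho> p (\<D> f p) = (\<lambda>_. 0)"
    and act_pair: "\<And>x y z p. x \<in> \<Gamma> \<Longrightarrow> y \<in> \<Gamma> \<Longrightarrow> z \<in> \<Gamma> \<Longrightarrow>
          act x (pair y z) p =
          pair (\<lambda>p. br x y p + \<D> (pair x y) p) z p + pair y (\<lambda>p. br x z p + \<D> (pair x z) p) p"


section \<open>Leibniz and Lie algebras\<close>

text \<open>
  A real vector space with a bilinear product is a module record over \<open>\<real>\<close>, with
  the product (or Lie bracket) in the field \<^const>\<open>mult\<close>.  The field \<^const>\<open>one\<close> is never used.
\<close>

definition real_scalars :: "real ring" where
  "real_scalars = \<lparr>carrier = UNIV, mult = (*), one = 1, zero = 0, add = (+)\<rparr>"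

definition nonassoc_algebra :: "(real, 'a) module \<Rightarrow> bool" where
  "nonassoc_algebra M \<longleftrightarrow>
     Module.module real_scalars M \<and>
     (\<forall>x\<in>carrier M. \<forall>y\<in>carrier M. x \<otimes>\<^bsub>M\<^esub> y \<in> carrier M) \<and>
     (\<forall>x\<in>carrier M. \<forall>y\<in>carrier M. \<forall>z\<in>carrier M.
        (x \<oplus>\<^bsub>M\<^esub> y) \<otimes>\<^bsub>M\<^esub> z = (x \<otimes>\<^bsub>M\<^esub> z) \<oplus>\<^bsub>M\<^esub> (y \<otimes>\<^bsub>M\<^esub> z) \<and>
        z \<otimes>\<^bsub>M\<^esub> (x \<oplus>\<^bsub>M\<^esub> y) = (z \<otimes>\<^bsub>M\<^esub> x) \<oplus>\<^bsub>M\<^esub> (z \<otimes>\<^bsub>M\<^esub> y)) \<and>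
     (\<forall>r. \<forall>x\<in>carrier M. \<forall>y\<in>carrier M.
        (r \<odot>\<^bsub>M\<^esub> x) \<otimes>\<^bsub>M\<^esub> y = r \<odot>\<^bsub>M\<^esub> (x \<otimes>\<^bsub>M\<^esub> y) \<and>
        x \<otimes>\<^bsub>M\<^esub> (r \<odot>\<^bsub>M\<^esub> y) = r \<odot>\<^bsub>M\<^esub> (x \<otimes>\<^bsub>M\<^esub> y))"

definition leibniz_algebra :: "(real, 'a) module \<Rightarrow> bool" where
  "leibniz_algebra M \<longleftrightarrow>
     nonassoc_algebra M \<and>
     (\<forall>x\<in>carrier M. \<forall>y\<in>carrier M. \<forall>z\<in>carrier M.
        x \<otimes>\<^bsub>M\<^esub> (y \<otimes>\<^bsub>M\<^esub> z) = ((x \<otimes>\<^bsub>M\<^esub> y) \<otimes>\<^bsub>M\<^esub> z) \<oplus>\<^bsub>M\<^esub> (y \<otimes>\<^bsub>M\<^esub> (x \<otimes>\<^bsub>M\<^esub> z)))"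

definition lie_algebra :: "(real, 'a) module \<Rightarrow> bool" where
  "lie_algebra M \<longleftrightarrow>
     nonassoc_algebra M \<and>
     (\<forall>x\<in>carrier M. x \<otimes>\<^bsub>M\<^esub> x = \<zero>\<^bsub>M\<^esub>) \<and>
     (\<forall>x\<in>carrier M. \<forall>y\<in>carrier M. \<forall>z\<in>carrier M.
        ((x \<otimes>\<^bsub>M\<^esub> y) \<otimes>\<^bsub>M\<^esub> z) \<oplus>\<^bsub>M\<^esub> ((y \<otimes>\<^bsub>M\<^esub> z) \<otimes>\<^bsub>M\<^esub> x) \<oplus>\<^bsub>M\<^esub> ((z \<otimes>\<^bsub>M\<^esub> x) \<otimes>\<^bsub>M\<^esub> y) = \<zero>\<^bsub>M\<^esub>)"

definition linear_hom :: "(real, 'a) module \<Rightarrow> (real, 'b) module \<Rightarrow> ('a \<Rightarrow> 'b) \<Rightarrow> bool" where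
  "linear_hom M N f \<longleftrightarrow>
     f \<in> carrier M \<rightarrow> carrier N \<and>
     (\<forall>x\<in>carrier M. \<forall>y\<in>carrier M. f (x \<oplus>\<^bsub>M\<^esub> y) = f x \<oplus>\<^bsub>N\<^esub> f y) \<and>
     (\<forall>r. \<forall>x\<in>carrier M. f (r \<odot>\<^bsub>M\<^esub> x) = r \<odot>\<^bsub>N\<^esub> f x)"

definition lie_hom :: "(real, 'a) module \<Rightarrow> (real, 'b) module \<Rightarrow> ('a \<Rightarrow> 'b) \<Rightarrow> bool" where
  "lie_hom M N f \<longleftrightarrow>
     linear_hom M N f \<and>
     (\<forall>x\<in>carrier M. \<forall>y\<in>carrier M. f (x \<otimes>\<^bsub>M\<^esub> y) = f x \<otimes>\<^bsub>N\<^esub> f y)"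

definition subalgebra :: "'a set \<Rightarrow> (real, 'a) module \<Rightarrow> bool" where
  "subalgebra S M \<longleftrightarrow> submodule S real_scalars M \<and> (\<forall>x\<in>S. \<forall>y\<in>S. x \<otimes>\<^bsub>M\<^esub> y \<in> S)"

definition two_sided_ideal :: "'a set \<Rightarrow> (real, 'a) module \<Rightarrow> bool" where
  "two_sided_ideal I M \<longleftrightarrow>
     submodule I real_scalars M \<and>
     (\<forall>x\<in>carrier M. \<forall>i\<in>I. x \<otimes>\<^bsub>M\<^esub> i \<in> I \<and> i \<otimes>\<^bsub>M\<^esub> x \<in> I)"

text \<open>
  The Lie algebra \<open>Der(M)\<close> under the commutator bracket.  Maps are extensional on the carrier,
  so that equality in it is equality of functions.
\<close>

definition derivation_algebra :: "(real, 'a) module \<Rightarrow> (real, 'a \<Rightarrow> 'a) module" where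
  "derivation_algebra M =
     \<lparr>carrier = {d \<in> extensional (carrier M). linear_hom M M d \<and>
        (\<forall>x\<in>carrier M. \<forall>y\<in>carrier M.
           d (x \<otimes>\<^bsub>M\<^esub> y) = (d x \<otimes>\<^bsub>M\<^esub> y) \<oplus>\<^bsub>M\<^esub> (x \<otimes>\<^bsub>M\<^esub> d y))},
      mult = (\<lambda>d e. \<lambda>x\<in>carrier M. d (e x) \<ominus>\<^bsub>M\<^esub> e (d x)),
      one = (\<lambda>x\<in>carrier M. \<zero>\<^bsub>M\<^esub>),
      zero = (\<lambda>x\<in>carrier M. \<zero>\<^bsub>M\<^esub>),
      add = (\<lambda>d e. \<lambda>x\<in>carrier M. d x \<oplus>\<^bsub>M\<^esub> e x),
      smult = (\<lambda>r d. \<lambda>x\<in>carrier M. r \<odot>\<^bsub>M\<^esub> d x)\<rparr>"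

definition left_mult :: "(real, 'a) module \<Rightarrow> 'a \<Rightarrow> 'a \<Rightarrow> 'a" where
  "left_mult M x = (\<lambda>y\<in>carrier M. x \<otimes>\<^bsub>M\<^esub> y)"

definition left_mult_kernel :: "(real, 'a) module \<Rightarrow> 'a set" where
  "left_mult_kernel M = {x \<in> carrier M. left_mult M x = \<zero>\<^bsub>derivation_algebra M\<^esub>}"

text \<open>\<open>FactRing\<close> already carries the induced addition and product; add the induced scaling.\<close>

definition quotient_algebra :: "(real, 'a) module \<Rightarrow> 'a set \<Rightarrow> (real, 'a set) module" where
  "quotient_algebra M I =
     ring.extend (FactRing M I) \<lparr>smult = (\<lambda>r C. \<Union>a\<in>C. I +>\<^bsub>M\<^esub> (r \<odot>\<^bsub>M\<^esub> a))\<rparr>"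

definition coset_map :: "(real, 'a) module \<Rightarrow> 'a set \<Rightarrow> 'a \<Rightarrow> 'a set" where
  "coset_map M I x = I +>\<^bsub>M\<^esub> x"

text \<open>The action of \<open>M/I\<close> on \<open>M\<close> by left multiplication with any representative.\<close>

definition quotient_action :: "(real, 'a) module \<Rightarrow> 'a set \<Rightarrow> 'a \<Rightarrow> 'a" where
  "quotient_action M C = (THE d. \<forall>a\<in>C. left_mult M a = d)"

text \<open>The semidirect product of \<open>H\<close> with \<open>M\<close>, the latter regarded as an abelian Lie algebra.\<close>

definition semidirect_product ::
  "(real, 'h) module \<Rightarrow> (real, 'a) module \<Rightarrow> ('h \<Rightarrow> 'a \<Rightarrow> 'a) \<Rightarrow> (real, 'h \<times> 'a) module" where
  "semidirect_product H M act =
     \<lparr>carrier = carrier H \<times> carrier M,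
      mult = (\<lambda>u v. (fst u \<otimes>\<^bsub>H\<^esub> fst v, act (fst u) (snd v) \<ominus>\<^bsub>M\<^esub> act (fst v) (snd u))),
      one = (\<zero>\<^bsub>H\<^esub>, \<zero>\<^bsub>M\<^esub>),
      zero = (\<zero>\<^bsub>H\<^esub>, \<zero>\<^bsub>M\<^esub>),
      add = (\<lambda>u v. (fst u \<oplus>\<^bsub>H\<^esub> fst v, snd u \<oplus>\<^bsub>M\<^esub> snd v)),
      smult = (\<lambda>r u. (r \<odot>\<^bsub>H\<^esub> fst u, r \<odot>\<^bsub>M\<^esub> snd u))\<rparr>"

text \<open>\<open>(G, H, f)\<close> is an enveloping Lie algebra of \<open>M\<close>, for the derivation action \<open>act\<close> of \<open>H\<close>.\<close>

definition enveloping_lie_algebra ::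
  "(real, 'h \<times> 'a) module \<Rightarrow> (real, 'h) module \<Rightarrow> ('h \<Rightarrow> 'a \<Rightarrow> 'a) \<Rightarrow> ('a \<Rightarrow> 'h) \<Rightarrow>
   (real, 'a) module \<Rightarrow> bool" where
  "enveloping_lie_algebra G H act f M \<longleftrightarrow>
     leibniz_algebra M \<and>
     lie_algebra H \<and>
     lie_hom H (derivation_algebra M) act \<and>
     linear_hom M H f \<and>
     (\<forall>\<xi>\<in>carrier H. \<forall>x\<in>carrier M. \<xi> \<otimes>\<^bsub>H\<^esub> f x = f (act \<xi> x)) \<and>
     (\<forall>x\<in>carrier M. \<forall>y\<in>carrier M. act (f x) y = x \<otimes>\<^bsub>M\<^esub> y) \<and>
     G = semidirect_product H M act \<and>
     lie_algebra G"

text \<open>The projection onto the subspace \<open>S\<close> along a complementary subspace \<open>N\<close>.\<close>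

definition complementary :: "(real, 'a) module \<Rightarrow> 'a set \<Rightarrow> 'a set \<Rightarrow> bool" where
  "complementary M S N \<longleftrightarrow>
     submodule S real_scalars M \<and> submodule N real_scalars M \<and>
     S \<inter> N = {\<zero>\<^bsub>M\<^esub>} \<and> S <+>\<^bsub>M\<^esub> N = carrier M"

definition projection_along :: "(real, 'a) module \<Rightarrow> 'a set \<Rightarrow> 'a set \<Rightarrow> 'a \<Rightarrow> 'a" where
  "projection_along M S N u = (THE s. s \<in> S \<and> (\<exists>n\<in>N. u = s \<oplus>\<^bsub>M\<^esub> n))"


section \<open>The Leibniz algebra of sections of a Courant algebroid\<close>

definition courant_leibniz_algebra ::
  "('p, 'm::real_inner) chart set \<Rightarrow> ('p \<Rightarrow> 'e::real_vector set) \<Rightarrow>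
   ('p, 'e, 'f::real_inner) trivialization set \<Rightarrow> ('p \<Rightarrow> 'e \<Rightarrow> 'e \<Rightarrow> real) \<Rightarrow>
   (('p \<Rightarrow> 'e) \<Rightarrow> ('p \<Rightarrow> 'e) \<Rightarrow> ('p \<Rightarrow> 'e)) \<Rightarrow> (('p \<Rightarrow> real) \<Rightarrow> ('p \<Rightarrow> 'e)) \<Rightarrow>
   (real, 'p \<Rightarrow> 'e) module" where
  "courant_leibniz_algebra \<A> fib \<T> form br \<D> =
     \<lparr>carrier = sections \<A> fib \<T>,
      mult = (\<lambda>x y p. br x y p + \<D> (\<lambda>p. form p (x p) (y p)) p),
      one = (\<lambda>p. 0),
      zero = (\<lambda>p. 0),
      add = (\<lambda>x y p. x p + y p),
      smult = (\<lambda>r x p. r *\<^sub>R x p)\<rparr>"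

end

theory Submission
  imports Defs
begin

text \<open>
  Write \<open>x \<cdot> y\<close> for the product of sections, \<open>\<lbrakk>x, y\<rbrakk> + \<D>\<langle>x, y\<rangle>\<close>.  The axioms say that
  \<open>x \<cdot> _\<close> acts on pairings as a derivation along \<open>\<rho>(x)\<close>.  Pairing with an arbitrary section
  gives \<open>x \<cdot> \<D>f = \<D>(\<rho>(x) f)\<close> (\<open>dorfman_D\<close>), and since \<open>x \<cdot> y + y \<cdot> x = 2 \<D>\<langle>x, y\<rangle>\<close> it
  follows that \<open>\<D>f \<cdot> x = 0\<close> (\<open>dorfman_D_left\<close>).  So the image of \<open>\<D>\<close> is a two-sided ideal that
  contains all squares and acts trivially from the left.  These facts turn the Jacobi identity with
  anomaly \<open>\<D>T\<close> into the Leibniz identity (\<open>dorfman_leibniz\<close>), once \<open>T\<close> has been computed in terms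
  of the product (\<open>four_T_eq\<close>).

  Pairing with all sections determines a section only if there are enough of them: each vector of a
  fibre must extend to a global section (\<open>section_through\<close>).  This is the analytic part of the
  proof; it uses bump functions built from \<open>exp (-1/t)\<close>, and it also supplies linearity of \<open>\<D>\<close>.

  The rest is pure algebra.  If an ideal \<open>I\<close> of a Leibniz algebra contains the squares and lies in the
  kernel of left multiplication, then the quotient by \<open>I\<close> is a Lie algebra which acts by derivations,
  and the semidirect product is an enveloping Lie algebra (\<open>enveloping_quotient\<close>).  In it the points
  \<open>(1/2 q(x), x)\<close> and \<open>(1/2 q(y), y)\<close> have a bracket with second component
  \<open>1/2 (x \<cdot> y - y \<cdot> x)\<close>, the skew part of the product, which is \<open>\<lbrakk>x, y\<rbrakk>\<close>
  (\<open>half_graph_bracket\<close>).  The projection onto the graph along the first factor keeps the second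
  component (\<open>graph_complementary\<close>).
\<close>

section \<open>Calculus of \<open>C\<^sup>k\<close> functions and compactness of balls\<close>

lemma frechet_derivative_eqI:
  "(f has_derivative f') (at x) \<Longrightarrow> frechet_derivative f (at x) v = f' v"
  by (metis frechet_derivative_at)

lemma differentiable_frechet:
  "f differentiable (at x) \<Longrightarrow> (f has_derivative frechet_derivative f (at x)) (at x)"
  by (simp add: frechet_derivative_works)

lemma Ck_on_cong:
  assumes "open U" "\<And>x. x \<in> U \<Longrightarrow> f x = g x" "Ck_on k U f"
  shows "Ck_on k U g"
  using assms(2,3)
proof (induction k arbitrary: f g)
  case 0
  then show ?case using continuous_on_cong[of U U f g] by simp
next
  case (Suc k)
  have der: "(g has_derivative frechet_derivative f (at x)) (at x)" if "x \<in> U" for x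
    using has_derivative_transform_within_open[OF differentiable_frechet assms(1) that]
      Suc.prems that by auto
  have "Ck_on k U (\<lambda>x. frechet_derivative g (at x) v)" for v
  proof (rule Suc.IH)
    show "Ck_on k U (\<lambda>x. frechet_derivative f (at x) v)" using Suc.prems by simp
    show "frechet_derivative f (at x) v = frechet_derivative g (at x) v" if "x \<in> U" for x
      using frechet_derivative_eqI[OF der[OF that]] by simp
  qed
  then show ?case using der by (auto simp: differentiable_def)
qed

lemma Ck_on_SucI:
  assumes "open U" "\<And>x. x \<in> U \<Longrightarrow> (f has_derivative f' x) (at x)"
    and "\<And>v. Ck_on k U (\<lambda>x. f' x v)"
  shows "Ck_on (Suc k) U f"
proof -
  have "Ck_on k U (\<lambda>x. frechet_derivative f (at x) v)" for v
    by (rule Ck_on_cong[OF assms(1) _ assms(3)[of v]])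
      (simp add: frechet_derivative_eqI[OF assms(2)])
  then show ?thesis using assms(2) by (auto simp: differentiable_def)
qed

lemma Ck_on_SucD:
  "Ck_on (Suc k) U f \<Longrightarrow> Ck_on k U f"
proof (induction k arbitrary: f)
  case 0
  then show ?case
    by (auto intro!: continuous_at_imp_continuous_on differentiable_imp_continuous_within)
next
  case (Suc k)
  then show ?case by (metis Ck_on.simps(2))
qed

lemma Ck_on_subset: "Ck_on k U f \<Longrightarrow> V \<subseteq> U \<Longrightarrow> Ck_on k V f"
  by (induction k arbitrary: f) (auto intro: continuous_on_subset)

lemma Ck_on_local:
  assumes "\<And>x. x \<in> U \<Longrightarrow> \<exists>V. open V \<and> x \<in> V \<and> Ck_on k V f"
  shows "Ck_on k U f"
  using assms
proof (induction k arbitrary: f)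
  case 0
  have "isCont f x" if "x \<in> U" for x
    using 0[OF that] by (metis Ck_on.simps(1) continuous_on_eq_continuous_at)
  then show ?case by (simp add: continuous_at_imp_continuous_on)
next
  case (Suc k)
  have "\<exists>V. open V \<and> x \<in> V \<and> Ck_on k V (\<lambda>x. frechet_derivative f (at x) v)" if "x \<in> U" for x v
    using Suc.prems[OF that] by auto
  moreover have "f differentiable at x" if "x \<in> U" for x
    using Suc.prems[OF that] by auto
  ultimately show ?case using Suc.IH by simp
qed

lemma Ck_on_const: "Ck_on k U (\<lambda>x. c)"
  by (induction k arbitrary: c) (simp_all add: frechet_derivative_eqI[OF has_derivative_const])

lemma Ck_on_add:
  assumes "open U" "Ck_on k U f" "Ck_on k U g"
  shows "Ck_on k U (\<lambda>x. f x + g x)"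
  using assms(2,3)
proof (induction k arbitrary: f g)
  case 0
  then show ?case by (simp add: continuous_on_add)
next
  case (Suc k)
  show ?case
    by (rule Ck_on_SucI[OF assms(1) has_derivative_add[OF differentiable_frechet differentiable_frechet]])
      (use Suc in auto)
qed

lemma (in bounded_bilinear) Ck_on:
  assumes "open U" "Ck_on k U f" "Ck_on k U g"
  shows "Ck_on k U (\<lambda>x. prod (f x) (g x))"
  using assms(2,3)
proof (induction k arbitrary: f g)
  case 0
  then show ?case by (simp add: continuous_on)
next
  case (Suc k)
  have "Ck_on k U f" "Ck_on k U g" using Suc.prems Ck_on_SucD by blast+
  then have c: "Ck_on k U (\<lambda>x. prod (f x) (frechet_derivative g (at x) v)
      + prod (frechet_derivative f (at x) v) (g x))" for v
    using Suc by (auto intro!: Ck_on_add assms(1))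
  show ?case
    by (rule Ck_on_SucI[OF assms(1) FDERIV[OF differentiable_frechet differentiable_frechet] c])
      (use Suc.prems in auto)
qed

text \<open>
  The outer function is given with all its derivatives \<open>h 0, h 1, \<dots>\<close>, so that the chain rule is
  an induction in which only \<open>n\<close> grows: the derivative of \<open>h n \<circ> g\<close> is a product with \<open>h (n+1) \<circ> g\<close>.
\<close>

lemma Ck_on_compose_real:
  fixes h :: "nat \<Rightarrow> real \<Rightarrow> real"
  assumes h: "\<And>n t. (h n has_real_derivative h (Suc n) t) (at t)"
    and U: "open U" and g: "Ck_on k U g"
  shows "Ck_on k U (\<lambda>x. h n (g x))"
  using g
proof (induction k arbitrary: n)
  case 0
  have "continuous_on UNIV (h n)"
    using h by (meson DERIV_isCont continuous_at_imp_continuous_on)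
  with 0 show ?case by (auto intro: continuous_on_compose2)
next
  case (Suc k)
  have "((\<lambda>x. h n (g x)) has_derivative (\<lambda>v. h (Suc n) (g x) * frechet_derivative g (at x) v)) (at x)"
    if "x \<in> U" for x
  proof -
    have "(h n has_derivative (*) (h (Suc n) (g x))) (at (g x))"
      using h by (simp add: has_field_derivative_def)
    moreover have "(g has_derivative frechet_derivative g (at x)) (at x)"
      using Suc.prems that by (auto intro: differentiable_frechet)
    ultimately show ?thesis using diff_chain_at by (fastforce simp: o_def)
  qed
  moreover have "Ck_on k U (\<lambda>x. h (Suc n) (g x) * frechet_derivative g (at x) v)" for v
    using Suc.IH[OF Ck_on_SucD[OF Suc.prems], of "Suc n"] Suc.prems
    by (intro bounded_bilinear.Ck_on[OF bounded_bilinear_mult] U) auto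
  ultimately show ?case by (rule Ck_on_SucI[OF U])
qed

text \<open>
  Derivatives of \<open>exp (-1/t)\<close> are again of the form \<open>P(1/t) exp (-1/t)\<close>; allowing a polynomial \<open>P\<close>
  makes this class of functions, extended by 0 to \<open>t \<le> 0\<close>, closed under differentiation.
\<close>

definition flat :: "real poly \<Rightarrow> real \<Rightarrow> real" where
  "flat P t = (if t > 0 then poly P (1/t) * exp (- (1/t)) else 0)"

lemma poly_times_exp_minus_tendsto_0: "((\<lambda>s. poly P s * exp (- s)) \<longlongrightarrow> (0::real)) at_top"
proof -
  have "((\<lambda>s. coeff P i * (s ^ i / exp s)) \<longlongrightarrow> coeff P i * (0::real)) at_top" for i
    by (intro tendsto_intros tendsto_power_div_exp_0)
  then have "((\<lambda>s. \<Sum>i\<le>degree P. coeff P i * (s ^ i / exp s)) \<longlongrightarrow> (\<Sum>i\<le>degree P. coeff P i * (0::real))) at_top"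
    by (intro tendsto_sum)
  then show ?thesis
    by (simp add: poly_altdef sum_divide_distrib exp_minus field_simps)
qed

lemma flat_tendsto_0: "(flat P \<longlongrightarrow> 0) (at 0)"
proof -
  have "((\<lambda>t. poly P (inverse t) * exp (- inverse t)) \<longlongrightarrow> (0::real)) (at_right 0)"
    using filterlim_compose[OF poly_times_exp_minus_tendsto_0 filterlim_inverse_at_top_right] .
  then have "(flat P \<longlongrightarrow> 0) (at_right 0)"
    by (rule filterlim_cong[THEN iffD1, rotated 3])
      (auto simp: flat_def eventually_at_filter inverse_eq_divide)
  moreover have "(flat P \<longlongrightarrow> 0) (at_left 0)"
    by (rule filterlim_cong[THEN iffD1, OF refl refl _ tendsto_const[of 0]])
      (auto simp: flat_def eventually_at_filter)
  ultimately show ?thesis by (simp add: filterlim_split_at)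
qed

text \<open>
  At 0 the difference quotient of \<open>flat P\<close> is \<open>flat\<close> of \<open>s P(s)\<close>, and this tends to 0.  Elsewhere,
  with \<open>s = 1/t\<close>, the derivative of \<open>P(s) exp (-s)\<close> in \<open>t\<close> is \<open>s\<^sup>2 (P - P')(s) exp (-s)\<close>.
\<close>

lemma flat_derivative:
  "(flat P has_real_derivative flat (monom 1 2 * (P - pderiv P)) t) (at t)"
proof -
  consider "t > 0" | "t < 0" | "t = 0" by linarith
  then show ?thesis
  proof cases
    case 1
    have "((\<lambda>t. poly P (1/t) * exp (- (1/t))) has_real_derivative
        flat (monom 1 2 * (P - pderiv P)) t) (at t)"
      using 1 by (auto intro!: derivative_eq_intros
          simp: flat_def poly_monom field_simps power2_eq_square)
    then show ?thesis
      by (rule has_field_derivative_transform_within_open[where S="{0<..}"])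
        (use 1 in \<open>auto simp: flat_def\<close>)
  next
    case 2
    have "((\<lambda>t. 0) has_real_derivative flat (monom 1 2 * (P - pderiv P)) t) (at t)"
      using 2 by (auto simp: flat_def)
    then show ?thesis
      by (rule has_field_derivative_transform_within_open[where S="{..<0}"])
        (use 2 in \<open>auto simp: flat_def\<close>)
  next
    case 3
    have "(\<lambda>t. (flat P t - flat P 0) / (t - 0)) = flat (pCons 0 P)"
      by (auto simp: flat_def)
    then show ?thesis using 3 flat_tendsto_0[of "pCons 0 P"]
      by (simp add: has_field_derivative_iff) (simp add: flat_def)
  qed
qed

lemma Ck_on_flat:
  assumes "open U" "Ck_on k U g"
  shows "Ck_on k U (\<lambda>x. flat P (g x))"
  using Ck_on_compose_real[of "\<lambda>n. flat (((\<lambda>P. monom 1 2 * (P - pderiv P)) ^^ n) P)" U k g 0]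
    assms by (simp add: flat_derivative)

text \<open>
  The difference of the two sides is orthogonal to the spanning set \<open>C\<close>, hence to itself.  A vector
  \<open>0 \<in> C\<close> is harmless: division by zero gives coefficient 0.
\<close>

lemma orthogonal_expansion:
  fixes x :: "'m::real_inner"
  assumes "finite C" "pairwise orthogonal C" "span C = UNIV"
  shows "x = (\<Sum>c\<in>C. ((x \<bullet> c) / (c \<bullet> c)) *\<^sub>R c)"
proof -
  define y where "y = x - (\<Sum>c\<in>C. ((x \<bullet> c) / (c \<bullet> c)) *\<^sub>R c)"
  have "orthogonal y d" if d: "d \<in> C" for d
  proof -
    have "(\<Sum>c\<in>C. ((x \<bullet> c) / (c \<bullet> c)) *\<^sub>R c) \<bullet> d = (\<Sum>c\<in>C. if c = d then x \<bullet> d else 0)"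
      unfolding inner_sum_left
      using assms(2) d by (intro sum.cong) (auto simp: pairwise_def orthogonal_def)
    also have "\<dots> = x \<bullet> d" using d assms(1) by simp
    finally show ?thesis by (simp add: y_def orthogonal_def inner_diff_left)
  qed
  then have "orthogonal y y"
    using assms(3) by (intro orthogonal_to_span[of y C]) auto
  then show ?thesis by (simp add: y_def orthogonal_def)
qed

lemma finite_dimensional_orthogonal_basis:
  assumes "finite_dimensional TYPE('m::real_inner)"
  obtains C :: "'m::real_inner set" where "finite C" "pairwise orthogonal C" "span C = UNIV"
  using assms basis_orthogonal unfolding finite_dimensional_def by metis

lemma compact_linear_combinations:
  fixes C :: "'m::real_normed_vector set"
  assumes "finite C"
  shows "\<exists>K. compact K \<and> (\<forall>k. (\<forall>c\<in>C. k c \<in> {-M c..M c::real}) \<longrightarrow> (\<Sum>c\<in>C. k c *\<^sub>R c) \<in> K)"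
  using assms
proof (induction rule: finite_induct)
  case empty
  show ?case by (intro exI[of _ "{0}"]) simp
next
  case (insert c F)
  then obtain K where K: "compact K"
    "\<And>k. \<forall>c\<in>F. k c \<in> {-M c..M c} \<Longrightarrow> (\<Sum>c\<in>F. k c *\<^sub>R c) \<in> K" by blast
  let ?L = "(\<lambda>t. t *\<^sub>R c) ` {-M c..M c}"
  have "compact ?L" by (intro compact_continuous_image continuous_intros compact_Icc)
  with K(1) have "compact {x + y | x y. x \<in> ?L \<and> y \<in> K}" by (rule compact_sums[rotated])
  moreover have "(\<Sum>c\<in>insert c F. k c *\<^sub>R c) \<in> {x + y | x y. x \<in> ?L \<and> y \<in> K}"
    if "\<forall>c\<in>insert c F. k c \<in> {-M c..M c}" for k
  proof -
    have "k c *\<^sub>R c \<in> ?L" "(\<Sum>c\<in>F. k c *\<^sub>R c) \<in> K" using that K(2)[of k] by auto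
    then show ?thesis using insert.hyps by auto
  qed
  ultimately show ?case by blast
qed

text \<open>
  The model space is not assumed to be of class \<^class>\<open>euclidean_space\<close>, so Heine-Borel is derived
  here: by the Cauchy-Schwarz inequality the coefficients of the points of a ball with respect to an
  orthogonal basis are bounded, and linear combinations with bounded coefficients form a compact set.
\<close>

lemma compact_cball_finite_dimensional:
  fixes a :: "'m::real_inner"
  assumes "finite_dimensional TYPE('m)"
  shows "compact (cball a r)"
proof -
  obtain C :: "'m set" where C: "finite C" "pairwise orthogonal C" "span C = UNIV"
    using finite_dimensional_orthogonal_basis[OF assms] .
  obtain K where K: "compact K"
    "\<And>k. \<forall>c\<in>C. k c \<in> {-((norm a + r) * norm c / (c \<bullet> c))..(norm a + r) * norm c / (c \<bullet> c)} \<Longrightarrow> (\<Sum>c\<in>C. k c *\<^sub>R c) \<in> K"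
    using compact_linear_combinations[OF C(1), of "\<lambda>c. (norm a + r) * norm c / (c \<bullet> c)"] by blast
  have "cball a r \<subseteq> K"
  proof
    fix x assume "x \<in> cball a r"
    then have x: "norm x \<le> norm a + r"
      by (metis add_left_mono dist_norm mem_cball norm_minus_commute norm_triangle_sub order_trans)
    have "(x \<bullet> c) / (c \<bullet> c) \<in> {-((norm a + r) * norm c / (c \<bullet> c))..(norm a + r) * norm c / (c \<bullet> c)}" for c
    proof -
      have "\<bar>x \<bullet> c\<bar> \<le> norm x * norm c" by (rule Cauchy_Schwarz_ineq2)
      also have "\<dots> \<le> (norm a + r) * norm c" using x by (simp add: mult_right_mono)
      finally have "\<bar>(x \<bullet> c) / (c \<bullet> c)\<bar> \<le> (norm a + r) * norm c / (c \<bullet> c)"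
        by (simp add: divide_right_mono)
      then show ?thesis by (metis abs_le_iff atLeastAtMost_iff minus_le_iff)
    qed
    then have "(\<Sum>c\<in>C. ((x \<bullet> c) / (c \<bullet> c)) *\<^sub>R c) \<in> K" by (intro K(2) ballI)
    then show "x \<in> K" using orthogonal_expansion[OF C, of x] by simp
  qed
  then show ?thesis
    by (metis K(1) closed_cball closed_Int_compact Int_absorb2)
qed

section \<open>Smooth functions on manifolds and bump functions\<close>

locale manifold_atlas =
  fixes \<A> :: "('p::{t2_space, second_countable_topology}, 'm::real_inner) chart set"
  assumes smooth_manifold: "smooth_manifold \<A>"
begin

lemma chart_open: "c \<in> \<A> \<Longrightarrow> open (fst c)"
  and chart_homeomorphism:
    "c \<in> \<A> \<Longrightarrow> homeomorphism (fst c) (snd c ` fst c) (snd c) (chart_inv c)"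
  and chart_image_open: "c \<in> \<A> \<Longrightarrow> open (snd c ` fst c)"
  and chart_transition: "c \<in> \<A> \<Longrightarrow> d \<in> \<A> \<Longrightarrow>
    smooth_on (snd c ` (fst c \<inter> fst d)) (snd d \<circ> chart_inv c)"
  using smooth_manifold unfolding smooth_manifold_def by blast+

lemma chart_cover: obtains c where "c \<in> \<A>" "p \<in> fst c"
  using smooth_manifold unfolding smooth_manifold_def by (metis UNIV_I UN_iff)

lemma chart_inv_chart: "c \<in> \<A> \<Longrightarrow> p \<in> fst c \<Longrightarrow> chart_inv c (snd c p) = p"
  using chart_homeomorphism homeomorphism_apply1 by blast

lemma chart_open_image:
  assumes "c \<in> \<A>" "open W"
  shows "open (snd c ` (fst c \<inter> W))"
proof -
  have "openin (top_of_set (fst c)) (fst c \<inter> W)" using assms(2) by blast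
  then have "openin (top_of_set (snd c ` fst c)) (snd c ` (fst c \<inter> W))"
    by (rule homeomorphism_imp_open_map[OF chart_homeomorphism[OF assms(1)]])
  then show ?thesis
    using chart_image_open[OF assms(1)] by (simp add: openin_open_eq)
qed

lemma smooth_fun_on_iff:
  "smooth_fun_on \<A> W f \<longleftrightarrow>
    (\<forall>c\<in>\<A>. \<forall>k. Ck_on k (snd c ` (fst c \<inter> W)) (\<lambda>x. f (chart_inv c x)))"
  by (simp add: smooth_fun_on_def smooth_on_def o_def)

lemma smooth_fun_on_chart: "c \<in> \<A> \<Longrightarrow> smooth_fun_on \<A> (fst c) (snd c)"
  using chart_transition by (simp add: smooth_fun_on_def)

lemma smooth_fun_on_subset: "smooth_fun_on \<A> W f \<Longrightarrow> V \<subseteq> W \<Longrightarrow> smooth_fun_on \<A> V f"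
  unfolding smooth_fun_on_def smooth_on_def by (meson Ck_on_subset Int_mono image_mono order_refl)

lemma smooth_fun_on_cong:
  assumes "open W" "\<And>p. p \<in> W \<Longrightarrow> f p = g p" "smooth_fun_on \<A> W f"
  shows "smooth_fun_on \<A> W g"
  unfolding smooth_fun_on_def smooth_on_def
proof (intro ballI allI)
  fix c k assume c: "c \<in> \<A>"
  show "Ck_on k (snd c ` (fst c \<inter> W)) (g \<circ> chart_inv c)"
  proof (rule Ck_on_cong)
    show "open (snd c ` (fst c \<inter> W))" using chart_open_image[OF c assms(1)] .
    show "Ck_on k (snd c ` (fst c \<inter> W)) (f \<circ> chart_inv c)"
      using assms(3) c by (simp add: smooth_fun_on_def smooth_on_def)
  qed (use assms(2) c in \<open>auto simp: chart_inv_chart\<close>)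
qed

lemma smooth_fun_on_local:
  assumes "\<And>p. p \<in> W \<Longrightarrow> \<exists>V. open V \<and> p \<in> V \<and> smooth_fun_on \<A> V f"
  shows "smooth_fun_on \<A> W f"
  unfolding smooth_fun_on_def smooth_on_def
proof (intro ballI allI Ck_on_local)
  fix c k x assume c: "c \<in> \<A>" and "x \<in> snd c ` (fst c \<inter> W)"
  then obtain p where p: "p \<in> fst c" "p \<in> W" "x = snd c p" by blast
  obtain V where V: "open V" "p \<in> V" "smooth_fun_on \<A> V f" using assms[OF p(2)] by blast
  then show "\<exists>V. open V \<and> x \<in> V \<and> Ck_on k V (f \<circ> chart_inv c)"
    using p c by (intro exI[of _ "snd c ` (fst c \<inter> V)"])
      (auto simp: chart_open_image smooth_fun_on_def smooth_on_def)
qed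

lemma smooth_fun_on_const: "smooth_fun_on \<A> W (\<lambda>p. c)"
  by (simp add: smooth_fun_on_def smooth_on_def o_def Ck_on_const)

lemma smooth_fun_on_add:
  "open W \<Longrightarrow> smooth_fun_on \<A> W f \<Longrightarrow> smooth_fun_on \<A> W g \<Longrightarrow> smooth_fun_on \<A> W (\<lambda>p. f p + g p)"
  unfolding smooth_fun_on_iff by (intro ballI allI Ck_on_add chart_open_image) blast+

lemma smooth_fun_on_bilinear:
  assumes "bounded_bilinear m" "open W" "smooth_fun_on \<A> W f" "smooth_fun_on \<A> W g"
  shows "smooth_fun_on \<A> W (\<lambda>p. m (f p) (g p))"
  using assms(2-) unfolding smooth_fun_on_iff
  by (intro ballI allI bounded_bilinear.Ck_on[OF assms(1)] chart_open_image) blast+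

lemma smooth_fun_on_flat:
  "open W \<Longrightarrow> smooth_fun_on \<A> W g \<Longrightarrow> smooth_fun_on \<A> W (\<lambda>p. flat P (g p))"
  unfolding smooth_fun_on_iff by (intro ballI allI Ck_on_flat chart_open_image) blast+

lemma smooth_fun_on_sum:
  assumes "open W" "\<And>i. i \<in> S \<Longrightarrow> smooth_fun_on \<A> W (f i)"
  shows "smooth_fun_on \<A> W (\<lambda>p. \<Sum>i\<in>S. f i p)"
  using assms(2)
  by (induction S rule: infinite_finite_induct)
    (auto intro: smooth_fun_on_const smooth_fun_on_add[OF assms(1)])

lemma smooth_functions_add:
  "f \<in> smooth_functions \<A> \<Longrightarrow> g \<in> smooth_functions \<A> \<Longrightarrow> (\<lambda>p. f p + g p) \<in> smooth_functions \<A>"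
  by (simp add: smooth_functions_def smooth_fun_on_add)

lemma smooth_functions_scale:
  "f \<in> smooth_functions \<A> \<Longrightarrow> (\<lambda>p. r * f p) \<in> smooth_functions \<A>"
  by (simp add: smooth_functions_def smooth_fun_on_bilinear[OF bounded_bilinear_mult] smooth_fun_on_const)

lemma smooth_function_differentiable:
  assumes "f \<in> smooth_functions \<A>" "c \<in> \<A>" "p \<in> fst c"
  shows "(f \<circ> chart_inv c) differentiable (at (snd c p))"
proof -
  have "Ck_on (Suc 0) (snd c ` fst c) (f \<circ> chart_inv c)"
    using assms unfolding smooth_functions_def smooth_fun_on_def smooth_on_def
    by (auto simp del: Ck_on.simps)
  then show ?thesis using assms(3) by simp
qed

lemma tangent_apply_add:
  assumes "f \<in> smooth_functions \<A>" "g \<in> smooth_functions \<A>"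
  shows "tangent_apply \<A> p v (\<lambda>p. f p + g p) = tangent_apply \<A> p v f + tangent_apply \<A> p v g"
proof -
  define c where "c = (SOME c. c \<in> \<A> \<and> p \<in> fst c)"
  have c: "c \<in> \<A>" "p \<in> fst c"
    using someI_ex[of "\<lambda>c. c \<in> \<A> \<and> p \<in> fst c"] chart_cover[of p] unfolding c_def by metis+
  have "(((\<lambda>p. f p + g p) \<circ> chart_inv c) has_derivative
      (\<lambda>v. frechet_derivative (f \<circ> chart_inv c) (at (snd c p)) v
         + frechet_derivative (g \<circ> chart_inv c) (at (snd c p)) v)) (at (snd c p))"
    using has_derivative_add[OF differentiable_frechet differentiable_frechet,
        OF smooth_function_differentiable[OF assms(1) c] smooth_function_differentiable[OF assms(2) c]]
    by (simp add: o_def)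
  then show ?thesis
    unfolding tangent_apply_def c_def[symmetric] Let_def by (rule frechet_derivative_eqI)
qed

lemma tangent_apply_scale:
  assumes "f \<in> smooth_functions \<A>"
  shows "tangent_apply \<A> p v (\<lambda>p. r * f p) = r * tangent_apply \<A> p v f"
proof -
  define c where "c = (SOME c. c \<in> \<A> \<and> p \<in> fst c)"
  have c: "c \<in> \<A>" "p \<in> fst c"
    using someI_ex[of "\<lambda>c. c \<in> \<A> \<and> p \<in> fst c"] chart_cover[of p] unfolding c_def by metis+
  have "(((\<lambda>p. r * f p) \<circ> chart_inv c) has_derivative
      (\<lambda>v. r * frechet_derivative (f \<circ> chart_inv c) (at (snd c p)) v)) (at (snd c p))"
    using has_derivative_mult_right[OF differentiable_frechet,
        OF smooth_function_differentiable[OF assms c]]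
    by (simp add: o_def)
  then show ?thesis
    unfolding tangent_apply_def c_def[symmetric] Let_def by (rule frechet_derivative_eqI)
qed

text \<open>
  In a chart \<open>c\<close> around \<open>p\<close> the function is a multiple of \<open>exp (-1/(r\<^sup>2 - \<bar>y - c(p)\<bar>\<^sup>2))\<close> in the ball
  of radius \<open>r\<close> and 0 outside it, and \<open>K\<close> is the preimage of the closed ball.  Compactness of \<open>K\<close>
  is what makes \<open>K\<close> closed in the whole manifold and so permits extension by 0 beyond the chart.
\<close>

lemma bump_function:
  assumes "open W" "p \<in> W"
  obtains c \<phi> K where "c \<in> \<A>" "p \<in> fst c" "smooth_fun_on \<A> (fst c) \<phi>" "\<phi> p = (1::real)"
    "closed K" "K \<subseteq> fst c \<inter> W" "\<And>q. q \<in> fst c - K \<Longrightarrow> \<phi> q = 0"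
proof -
  obtain c where c: "c \<in> \<A>" "p \<in> fst c" by (rule chart_cover)
  define a where "a = snd c p"
  have "a \<in> snd c ` (fst c \<inter> W)" using c assms by (auto simp: a_def)
  then obtain r where r: "r > 0" "cball a r \<subseteq> snd c ` (fst c \<inter> W)"
    using chart_open_image[OF c(1) assms(1)] open_contains_cball by blast
  define g where "g q = r\<^sup>2 + (-1) * ((snd c q + (-a)) \<bullet> (snd c q + (-a)))" for q
  define K where "K = chart_inv c ` cball a r"
  have "continuous_on (cball a r) (chart_inv c)"
    using homeomorphism_cont2[OF chart_homeomorphism[OF c(1)]] r(2) continuous_on_subset by blast
  then have "compact K" unfolding K_def
    using smooth_manifold
    by (auto intro!: compact_continuous_image compact_cball_finite_dimensional simp: smooth_manifold_def)
  then have "closed K" by (rule compact_imp_closed)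
  have "K \<subseteq> fst c \<inter> W"
    using r(2) chart_inv_chart[OF c(1)] unfolding K_def by fastforce
  have "smooth_fun_on \<A> (fst c) g" unfolding g_def
    by (intro smooth_fun_on_add smooth_fun_on_bilinear[OF bounded_bilinear_mult]
        smooth_fun_on_bilinear[OF bounded_bilinear_inner] smooth_fun_on_const
        smooth_fun_on_chart chart_open c(1))
  then have "smooth_fun_on \<A> (fst c) (\<lambda>q. inverse (flat 1 (r\<^sup>2)) * flat 1 (g q))"
    by (intro smooth_fun_on_bilinear[OF bounded_bilinear_mult] smooth_fun_on_const
        smooth_fun_on_flat chart_open c(1))
  moreover have "inverse (flat 1 (r\<^sup>2)) * flat 1 (g p) = 1"
    using r(1) by (simp add: g_def a_def flat_def)
  moreover have "inverse (flat 1 (r\<^sup>2)) * flat 1 (g q) = 0" if q: "q \<in> fst c - K" for q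
  proof -
    have "snd c q \<notin> cball a r"
      using q chart_inv_chart[OF c(1)] unfolding K_def by (metis DiffE image_eqI)
    then have "r \<le> norm (snd c q - a)" by (simp add: dist_norm norm_minus_commute)
    then have "r\<^sup>2 \<le> (norm (snd c q - a))\<^sup>2" using r(1) by (simp add: power_mono)
    then show ?thesis by (simp add: g_def flat_def dot_square_norm)
  qed
  ultimately show thesis
    by (rule that[OF c _ _ \<open>closed K\<close> \<open>K \<subseteq> fst c \<inter> W\<close>])
qed

end

section \<open>Sections of vector bundles\<close>

locale vector_bundle = manifold_atlas \<A>
  for \<A> :: "('p::{t2_space, second_countable_topology}, 'm::real_inner) chart set" +
  fixes fib :: "'p \<Rightarrow> 'e::real_vector set"
    and \<T> :: "('p, 'e, 'f::real_inner) trivialization set"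
  assumes smooth_vector_bundle: "smooth_vector_bundle \<A> fib \<T>"
begin

lemma fibre_subspace: "subspace (fib p)"
  and triv_open: "t \<in> \<T> \<Longrightarrow> open (fst t)"
  and triv_bij: "t \<in> \<T> \<Longrightarrow> p \<in> fst t \<Longrightarrow> bij_betw (snd t p) (fib p) UNIV"
  and triv_add: "t \<in> \<T> \<Longrightarrow> p \<in> fst t \<Longrightarrow> a \<in> fib p \<Longrightarrow> b \<in> fib p \<Longrightarrow>
    snd t p (a + b) = snd t p a + snd t p b"
  and triv_scale: "t \<in> \<T> \<Longrightarrow> p \<in> fst t \<Longrightarrow> a \<in> fib p \<Longrightarrow> snd t p (r *\<^sub>R a) = r *\<^sub>R snd t p a"
  and triv_transition: "t \<in> \<T> \<Longrightarrow> u \<in> \<T> \<Longrightarrow>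
    smooth_fun_on \<A> (fst t \<inter> fst u) (\<lambda>p. snd u p (triv_inv fib t p w))"
  and fibre_finite_dimensional: "finite_dimensional TYPE('f)"
  using smooth_vector_bundle unfolding smooth_vector_bundle_def by blast+

lemma triv_cover: obtains t where "t \<in> \<T>" "p \<in> fst t"
  using smooth_vector_bundle unfolding smooth_vector_bundle_def by (metis UNIV_I UN_iff)

lemma triv_inv_in: "t \<in> \<T> \<Longrightarrow> p \<in> fst t \<Longrightarrow> triv_inv fib t p w \<in> fib p"
  and triv_triv_inv: "t \<in> \<T> \<Longrightarrow> p \<in> fst t \<Longrightarrow> snd t p (triv_inv fib t p w) = w"
  and triv_inv_triv: "t \<in> \<T> \<Longrightarrow> p \<in> fst t \<Longrightarrow> a \<in> fib p \<Longrightarrow> triv_inv fib t p (snd t p a) = a"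
  using triv_bij[of t p] unfolding triv_inv_def bij_betw_def
  by (simp_all add: inv_into_into f_inv_into_f)

lemma triv_inv_sum:
  assumes "t \<in> \<T>" "p \<in> fst t" "finite C"
  shows "triv_inv fib t p (\<Sum>c\<in>C. k c *\<^sub>R c) = (\<Sum>c\<in>C. k c *\<^sub>R triv_inv fib t p c)"
proof -
  have sub: "subspace (fib p)" by (rule fibre_subspace)
  have "(\<Sum>c\<in>C. k c *\<^sub>R triv_inv fib t p c) \<in> fib p
    \<and> snd t p (\<Sum>c\<in>C. k c *\<^sub>R triv_inv fib t p c) = (\<Sum>c\<in>C. k c *\<^sub>R c)"
    using assms(3)
  proof (induction rule: finite_induct)
    case empty
    have "snd t p (0 *\<^sub>R 0) = 0 *\<^sub>R snd t p 0"
      using triv_scale[OF assms(1,2) subspace_0[OF sub]] .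
    then show ?case using subspace_0[OF sub] by simp
  next
    case (insert c F)
    then show ?case using triv_inv_in[OF assms(1,2)] sub
      by (simp add: triv_add[OF assms(1,2)] triv_scale[OF assms(1,2)] triv_triv_inv[OF assms(1,2)]
          subspace_add subspace_scale)
  qed
  then show ?thesis using triv_inv_triv[OF assms(1,2)] by metis
qed

lemma section_in_fibre: "s \<in> sections \<A> fib \<T> \<Longrightarrow> s p \<in> fib p"
  by (simp add: sections_def)

lemma section_zero: "(\<lambda>p. 0) \<in> sections \<A> fib \<T>"
  and section_add: "x \<in> sections \<A> fib \<T> \<Longrightarrow> y \<in> sections \<A> fib \<T> \<Longrightarrow>
    (\<lambda>p. x p + y p) \<in> sections \<A> fib \<T>"
  and section_scale: "x \<in> sections \<A> fib \<T> \<Longrightarrow> (\<lambda>p. r *\<^sub>R x p) \<in> sections \<A> fib \<T>"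
proof -
  have scale: "(\<lambda>p. r *\<^sub>R x p) \<in> sections \<A> fib \<T>"
    if "\<And>p. x p \<in> fib p" "\<And>t. t \<in> \<T> \<Longrightarrow> r = 0 \<or> smooth_fun_on \<A> (fst t) (\<lambda>p. snd t p (x p))" for r x
  proof -
    have "smooth_fun_on \<A> (fst t) (\<lambda>p. snd t p (r *\<^sub>R x p))" if t: "t \<in> \<T>" for t
    proof (rule smooth_fun_on_cong[OF triv_open[OF t]])
      show "r *\<^sub>R snd t p (x p) = snd t p (r *\<^sub>R x p)" if "p \<in> fst t" for p
        using triv_scale[OF t that] \<open>\<And>p. x p \<in> fib p\<close> by simp
      show "smooth_fun_on \<A> (fst t) (\<lambda>p. r *\<^sub>R snd t p (x p))"
        using \<open>t \<in> \<T> \<Longrightarrow> r = 0 \<or> smooth_fun_on \<A> (fst t) (\<lambda>p. snd t p (x p))\<close>[OF t]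
        by (auto intro: smooth_fun_on_const
            smooth_fun_on_bilinear[OF bounded_bilinear_scaleR triv_open[OF t]])
    qed
    then show ?thesis using that(1) subspace_scale[OF fibre_subspace] by (simp add: sections_def)
  qed
  show "(\<lambda>p. 0) \<in> sections \<A> fib \<T>"
    using scale[of "\<lambda>p. 0" 0] subspace_0[OF fibre_subspace] by simp
  show "(\<lambda>p. r *\<^sub>R x p) \<in> sections \<A> fib \<T>" if "x \<in> sections \<A> fib \<T>" for r
    using scale that by (simp add: sections_def)
  assume xy: "x \<in> sections \<A> fib \<T>" "y \<in> sections \<A> fib \<T>"
  have "smooth_fun_on \<A> (fst t) (\<lambda>p. snd t p (x p + y p))" if t: "t \<in> \<T>" for t
  proof (rule smooth_fun_on_cong[OF triv_open[OF t]])
    show "snd t p (x p) + snd t p (y p) = snd t p (x p + y p)" if "p \<in> fst t" for p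
      using triv_add[OF t that] xy by (simp add: sections_def)
    show "smooth_fun_on \<A> (fst t) (\<lambda>p. snd t p (x p) + snd t p (y p))"
      using xy t by (intro smooth_fun_on_add triv_open) (auto simp: sections_def)
  qed
  then show "(\<lambda>p. x p + y p) \<in> sections \<A> fib \<T>"
    using xy subspace_add[OF fibre_subspace] by (simp add: sections_def)
qed

text \<open>
  A vector of one fibre is extended with constant coordinates in a trivialization, and cut off by a
  bump function.  Thus statements about all sections control every fibre, which is what turns
  fibrewise nondegeneracy of a form into nondegeneracy on global sections.
\<close>

lemma section_through:
  assumes "a \<in> fib p"
  obtains s where "s \<in> sections \<A> fib \<T>" "s p = a"
proof -
  obtain t where t: "t \<in> \<T>" "p \<in> fst t" by (rule triv_cover)
  obtain c \<phi> K where \<phi>: "c \<in> \<A>" "p \<in> fst c" "smooth_fun_on \<A> (fst c) \<phi>" "\<phi> p = (1::real)"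
    "closed K" "K \<subseteq> fst c \<inter> fst t" "\<And>q. q \<in> fst c - K \<Longrightarrow> \<phi> q = 0"
    by (rule bump_function[OF triv_open[OF t(1)] t(2)]) (rule that, assumption+)
  define w where "w = snd t p a"
  define W where "W = fst c \<inter> fst t"
  have "open W" using chart_open[OF \<phi>(1)] triv_open[OF t(1)] by (simp add: W_def open_Int)
  define s where "s q = (if q \<in> W then \<phi> q *\<^sub>R triv_inv fib t q w else 0)" for q
  have fib: "s q \<in> fib q" for q
    using triv_inv_in[OF t(1)] subspace_scale[OF fibre_subspace] subspace_0[OF fibre_subspace]
    by (simp add: s_def W_def)
  have "smooth_fun_on \<A> (fst u) (\<lambda>q. snd u q (s q))" if u: "u \<in> \<T>" for u
  proof (rule smooth_fun_on_local)
    fix q assume q: "q \<in> fst u"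
    show "\<exists>V. open V \<and> q \<in> V \<and> smooth_fun_on \<A> V (\<lambda>q. snd u q (s q))"
    proof (cases "q \<in> W")
      case True
      let ?V = "W \<inter> fst u"
      have V: "open ?V" using \<open>open W\<close> triv_open[OF u] by blast
      have "smooth_fun_on \<A> ?V (\<lambda>q. snd u q (s q))"
      proof (rule smooth_fun_on_cong[OF V])
        show "\<phi> q *\<^sub>R snd u q (triv_inv fib t q w) = snd u q (s q)" if "q \<in> ?V" for q
          using that triv_scale[OF u] triv_inv_in[OF t(1)] by (simp add: s_def W_def)
        show "smooth_fun_on \<A> ?V (\<lambda>q. \<phi> q *\<^sub>R snd u q (triv_inv fib t q w))"
          by (rule smooth_fun_on_bilinear[OF bounded_bilinear_scaleR V])
            (auto intro: smooth_fun_on_subset[OF \<phi>(3)] smooth_fun_on_subset[OF triv_transition[OF t(1) u]]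
              simp: W_def)
      qed
      then show ?thesis using V True q by blast
    next
      case False
      let ?V = "- K \<inter> fst u"
      have V: "open ?V" using \<phi>(5) triv_open[OF u] by blast
      have "smooth_fun_on \<A> ?V (\<lambda>q. snd u q (s q))"
      proof (rule smooth_fun_on_cong[OF V _ smooth_fun_on_const])
        fix q assume "q \<in> ?V"
        then have "s q = 0 *\<^sub>R 0" "q \<in> fst u" using \<phi>(7)[of q] by (auto simp: s_def W_def)
        then show "0 = snd u q (s q)"
          using triv_scale[OF u _ subspace_0[OF fibre_subspace], of q 0] by simp
      qed
      then show ?thesis using V False q \<phi>(6) by (auto simp: W_def)
    qed
  qed
  then have "s \<in> sections \<A> fib \<T>" using fib by (simp add: sections_def)
  moreover have "s p = a"
    using \<phi>(2,4) t triv_inv_triv[OF t assms] by (simp add: s_def W_def w_def)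
  ultimately show thesis by (rule that)
qed

lemma form_add_left: "nondegenerate_symmetric_form \<A> fib \<T> form \<Longrightarrow>
    a \<in> fib p \<Longrightarrow> b \<in> fib p \<Longrightarrow> d \<in> fib p \<Longrightarrow> form p (a + b) d = form p a d + form p b d"
  and form_scale_left: "nondegenerate_symmetric_form \<A> fib \<T> form \<Longrightarrow>
    a \<in> fib p \<Longrightarrow> b \<in> fib p \<Longrightarrow> form p (r *\<^sub>R a) b = r * form p a b"
  and form_sym: "nondegenerate_symmetric_form \<A> fib \<T> form \<Longrightarrow>
    a \<in> fib p \<Longrightarrow> b \<in> fib p \<Longrightarrow> form p a b = form p b a"
  by (auto simp: nondegenerate_symmetric_form_def)

lemma form_sum_left:
  assumes form: "nondegenerate_symmetric_form \<A> fib \<T> form"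
    and "finite C" "\<And>c. c \<in> C \<Longrightarrow> e c \<in> fib p" "b \<in> fib p"
  shows "form p (\<Sum>c\<in>C. k c *\<^sub>R e c) b = (\<Sum>c\<in>C. k c * form p (e c) b)"
proof -
  have "(\<Sum>c\<in>C. k c *\<^sub>R e c) \<in> fib p \<and> ?thesis"
    using assms(2,3)
  proof (induction rule: finite_induct)
    case empty
    show ?case using form_scale_left[OF form subspace_0[OF fibre_subspace] assms(4), of 0]
      subspace_0[OF fibre_subspace] by simp
  next
    case (insert c F)
    then show ?case using assms(4) subspace_add[OF fibre_subspace] subspace_scale[OF fibre_subspace]
      by (simp add: form_add_left[OF form] form_scale_left[OF form])
  qed
  then show ?thesis ..
qed

text \<open>
  Smoothness of a form is given on constant coordinate vectors only; expanding both sections in an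
  orthogonal basis of the typical fibre reduces the general case to it.
\<close>

lemma smooth_form_of_sections:
  assumes form: "nondegenerate_symmetric_form \<A> fib \<T> form"
    and x: "x \<in> sections \<A> fib \<T>" and y: "y \<in> sections \<A> fib \<T>"
  shows "(\<lambda>p. form p (x p) (y p)) \<in> smooth_functions \<A>"
proof -
  obtain C :: "'f set" where C: "finite C" "pairwise orthogonal C" "span C = UNIV"
    using finite_dimensional_orthogonal_basis[OF fibre_finite_dimensional] .
  have "smooth_fun_on \<A> (fst t) (\<lambda>p. form p (x p) (y p))" if t: "t \<in> \<T>" for t
  proof (rule smooth_fun_on_cong[OF triv_open[OF t]])
    let ?k = "\<lambda>s c p. inverse (c \<bullet> c) * (snd t p (s p) \<bullet> c)"
    let ?e = "\<lambda>c p. triv_inv fib t p c"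
    have exp: "s p = (\<Sum>c\<in>C. ?k s c p *\<^sub>R ?e c p)" if "s \<in> sections \<A> fib \<T>" "p \<in> fst t" for s p
    proof -
      have "s p = triv_inv fib t p (\<Sum>c\<in>C. ?k s c p *\<^sub>R c)"
        using orthogonal_expansion[OF C, of "snd t p (s p)"] triv_inv_triv[OF t that(2)]
          section_in_fibre[OF that(1)] by (simp add: divide_inverse mult.commute)
      then show ?thesis using triv_inv_sum[OF t that(2) C(1), of "\<lambda>c. ?k s c p"] by simp
    qed
    have smooth: "smooth_fun_on \<A> (fst t) (?k s c)" if "s \<in> sections \<A> fib \<T>" for s c
      using that t
      by (intro smooth_fun_on_bilinear[OF bounded_bilinear_mult]
          smooth_fun_on_bilinear[OF bounded_bilinear_inner] smooth_fun_on_const triv_open)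
        (auto simp: sections_def)
    show "(\<Sum>c\<in>C. ?k x c p * (\<Sum>d\<in>C. ?k y d p * form p (?e d p) (?e c p))) = form p (x p) (y p)"
      if p: "p \<in> fst t" for p
    proof -
      have y: "form p (y p) (?e c p) = (\<Sum>d\<in>C. ?k y d p * form p (?e d p) (?e c p))" for c
        by (subst exp[OF y p], rule form_sum_left[OF form C(1)])
          (simp_all add: triv_inv_in[OF t p])
      have "form p (x p) (y p) = (\<Sum>c\<in>C. ?k x c p * form p (?e c p) (y p))"
        by (subst exp[OF x p], rule form_sum_left[OF form C(1)])
          (simp_all add: triv_inv_in[OF t p] section_in_fibre[OF assms(3)])
      also have "\<dots> = (\<Sum>c\<in>C. ?k x c p * form p (y p) (?e c p))"
        using form_sym[OF form triv_inv_in[OF t p] section_in_fibre[OF assms(3)]] by simp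
      also have "\<dots> = (\<Sum>c\<in>C. ?k x c p * (\<Sum>d\<in>C. ?k y d p * form p (?e d p) (?e c p)))"
        by (simp only: y)
      finally show ?thesis by simp
    qed
    show "smooth_fun_on \<A> (fst t) (\<lambda>p. \<Sum>c\<in>C. ?k x c p * (\<Sum>d\<in>C. ?k y d p * form p (?e d p) (?e c p)))"
      using form t
      by (intro smooth_fun_on_sum smooth_fun_on_bilinear[OF bounded_bilinear_mult] smooth x y triv_open)
        (auto simp: nondegenerate_symmetric_form_def)
  qed
  then have "smooth_fun_on \<A> UNIV (\<lambda>p. form p (x p) (y p))"
    by (intro smooth_fun_on_local) (metis triv_cover triv_open)
  then show ?thesis by (simp add: smooth_functions_def)
qed

end

section \<open>The Dorfman product of a Courant algebroid\<close>

lemma (in manifold_atlas) tangent_apply_zero: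
  assumes "f \<in> smooth_functions \<A>"
  shows "tangent_apply \<A> p (\<lambda>_. 0) f = 0"
proof -
  define c where "c = (SOME c. c \<in> \<A> \<and> p \<in> fst c)"
  have c: "c \<in> \<A>" "p \<in> fst c"
    using someI_ex[of "\<lambda>c. c \<in> \<A> \<and> p \<in> fst c"] chart_cover[of p] unfolding c_def by metis+
  show ?thesis
    unfolding tangent_apply_def c_def[symmetric] Let_def
    by (rule linear_0[OF has_derivative_linear[OF differentiable_frechet]])
      (rule smooth_function_differentiable[OF assms c])
qed

sublocale courant_algebroid \<subseteq> vb?: vector_bundle \<A> fib \<T>
  using manifold vector_bundle by unfold_locales

context courant_algebroid
begin

text \<open>
  The non-skew product \<open>x \<cdot> y\<close>, known as the Dorfman bracket.
\<close>

definition dorfman where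
  "dorfman x y = (\<lambda>p. br x y p + \<D> (pair x y) p)"

abbreviation smooth where
  "smooth \<equiv> smooth_functions \<A>"

lemma pair_smooth: "x \<in> \<Gamma> \<Longrightarrow> y \<in> \<Gamma> \<Longrightarrow> pair x y \<in> smooth"
  using smooth_form_of_sections[OF form] .

lemma pair_sym: "x \<in> \<Gamma> \<Longrightarrow> y \<in> \<Gamma> \<Longrightarrow> pair x y p = pair y x p"
  using form_sym[OF form] section_in_fibre by blast

lemma pair_add_left: "x \<in> \<Gamma> \<Longrightarrow> y \<in> \<Gamma> \<Longrightarrow> z \<in> \<Gamma> \<Longrightarrow>
    pair (\<lambda>p. x p + y p) z p = pair x z p + pair y z p"
  using form_add_left[OF form] section_in_fibre by blast

lemma pair_scale_left: "x \<in> \<Gamma> \<Longrightarrow> z \<in> \<Gamma> \<Longrightarrow> pair (\<lambda>p. r *\<^sub>R x p) z p = r * pair x z p"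
  using form_scale_left[OF form] section_in_fibre by blast

lemma pair_add_right: "x \<in> \<Gamma> \<Longrightarrow> y \<in> \<Gamma> \<Longrightarrow> z \<in> \<Gamma> \<Longrightarrow>
    pair z (\<lambda>p. x p + y p) p = pair z x p + pair z y p"
  using pair_add_left[of x y z p] pair_sym[of z x p] pair_sym[of z y p]
    pair_sym[of z "\<lambda>p. x p + y p" p] section_add[of x y] by simp

lemma pair_scale_right: "x \<in> \<Gamma> \<Longrightarrow> z \<in> \<Gamma> \<Longrightarrow> pair z (\<lambda>p. r *\<^sub>R x p) p = r * pair z x p"
  using pair_scale_left[of x z p r] pair_sym[of z x p]
    pair_sym[of z "\<lambda>p. r *\<^sub>R x p" p] section_scale[of x r] by simp

text \<open>
  Nondegeneracy for sections.  Linearity of \<open>\<D>\<close> and the formula for \<open>x \<cdot> \<D>f\<close> rest on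
  this, because \<open>\<D>\<close> is known only through its pairings.
\<close>

lemma section_eqI:
  assumes "x \<in> \<Gamma>" "y \<in> \<Gamma>" "\<And>z p. z \<in> \<Gamma> \<Longrightarrow> pair x z p = pair y z p"
  shows "x = y"
proof
  fix p
  let ?d = "\<lambda>p. x p + (-1) *\<^sub>R y p"
  have d: "?d \<in> \<Gamma>" using section_add[OF assms(1) section_scale[OF assms(2)]] .
  have "form p (?d p) b = 0" if b: "b \<in> fib p" for b
  proof -
    obtain z where z: "z \<in> \<Gamma>" "z p = b" using section_through[OF b] .
    have "pair ?d z p = pair x z p + (-1) * pair y z p"
      using pair_add_left[OF assms(1) section_scale[OF assms(2)] z(1), of p "-1"]
        pair_scale_left[OF assms(2) z(1), of p "-1"] by simp
    then show ?thesis using assms(3)[OF z(1), of p] z(2) by simp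
  qed
  moreover have "?d p \<in> fib p" using section_in_fibre[OF d] .
  ultimately have "?d p = 0" using form unfolding nondegenerate_symmetric_form_def by blast
  then show "x p = y p" by simp
qed

lemma act_eq_pair: "f \<in> smooth \<Longrightarrow> x \<in> \<Gamma> \<Longrightarrow> act x f = (\<lambda>p. 2 * pair (\<D> f) x p)"
  by (simp add: D_eq fun_eq_iff)

text \<open>
  That \<open>\<rho>(x) f\<close> is smooth needs no computation in charts: it is twice a pairing of two sections.
\<close>

lemma act_smooth: "f \<in> smooth \<Longrightarrow> x \<in> \<Gamma> \<Longrightarrow> act x f \<in> smooth"
  unfolding act_eq_pair using smooth_functions_scale pair_smooth D_closed by blast

lemma D_add:
  assumes "f \<in> smooth" "g \<in> smooth"
  shows "\<D> (\<lambda>p. f p + g p) = (\<lambda>p. \<D> f p + \<D> g p)"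
proof (rule section_eqI)
  show "pair (\<D> (\<lambda>p. f p + g p)) z p = pair (\<lambda>p. \<D> f p + \<D> g p) z p" if "z \<in> \<Gamma>" for z p
    unfolding pair_add_left[OF D_closed[OF assms(1)] D_closed[OF assms(2)] that]
      D_eq[OF assms(1) that] D_eq[OF assms(2) that] D_eq[OF smooth_functions_add[OF assms] that]
    by (simp add: vector_field_apply_def tangent_apply_add[OF assms])
qed (intro D_closed section_add smooth_functions_add assms)+

lemma D_scale:
  assumes "f \<in> smooth"
  shows "\<D> (\<lambda>p. r * f p) = (\<lambda>p. r *\<^sub>R \<D> f p)"
proof (rule section_eqI)
  show "pair (\<D> (\<lambda>p. r * f p)) z p = pair (\<lambda>p. r *\<^sub>R \<D> f p) z p" if "z \<in> \<Gamma>" for z p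
    unfolding pair_scale_left[OF D_closed[OF assms] that]
      D_eq[OF assms that] D_eq[OF smooth_functions_scale[OF assms] that]
    by (simp add: vector_field_apply_def tangent_apply_scale[OF assms])
qed (intro D_closed section_scale smooth_functions_scale assms)+

lemma act_D: "f \<in> smooth \<Longrightarrow> g \<in> smooth \<Longrightarrow> act (\<D> g) f p = 0"
  by (simp add: vector_field_apply_def anchor_D tangent_apply_zero)

lemma br_add_right:
  assumes "x \<in> \<Gamma>" "y \<in> \<Gamma>" "z \<in> \<Gamma>"
  shows "br z (\<lambda>p. x p + y p) = (\<lambda>p. br z x p + br z y p)"
  using br_skew[OF assms(3) section_add[OF assms(1,2)]] br_add[OF assms]
    br_skew[OF assms(3,1)] br_skew[OF assms(3,2)] by simp

lemma br_scale_right: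
  assumes "x \<in> \<Gamma>" "z \<in> \<Gamma>"
  shows "br z (\<lambda>p. r *\<^sub>R x p) = (\<lambda>p. r *\<^sub>R br z x p)"
  using br_skew[OF assms(2) section_scale[OF assms(1)]] br_scale[OF assms]
    br_skew[OF assms(2,1)] by simp

lemma dorfman_closed: "x \<in> \<Gamma> \<Longrightarrow> y \<in> \<Gamma> \<Longrightarrow> dorfman x y \<in> \<Gamma>"
  unfolding dorfman_def by (intro section_add br_closed D_closed pair_smooth)

lemma dorfman_add_left: "x \<in> \<Gamma> \<Longrightarrow> y \<in> \<Gamma> \<Longrightarrow> z \<in> \<Gamma> \<Longrightarrow>
    dorfman (\<lambda>p. x p + y p) z = (\<lambda>p. dorfman x z p + dorfman y z p)"
  by (simp add: dorfman_def br_add pair_add_left D_add pair_smooth algebra_simps)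

lemma dorfman_add_right: "x \<in> \<Gamma> \<Longrightarrow> y \<in> \<Gamma> \<Longrightarrow> z \<in> \<Gamma> \<Longrightarrow>
    dorfman z (\<lambda>p. x p + y p) = (\<lambda>p. dorfman z x p + dorfman z y p)"
  by (simp add: dorfman_def br_add_right pair_add_right D_add pair_smooth algebra_simps)

lemma dorfman_scale_left: "x \<in> \<Gamma> \<Longrightarrow> z \<in> \<Gamma> \<Longrightarrow>
    dorfman (\<lambda>p. r *\<^sub>R x p) z = (\<lambda>p. r *\<^sub>R dorfman x z p)"
  by (simp add: dorfman_def br_scale pair_scale_left D_scale pair_smooth algebra_simps)

lemma dorfman_scale_right: "x \<in> \<Gamma> \<Longrightarrow> z \<in> \<Gamma> \<Longrightarrow>
    dorfman z (\<lambda>p. r *\<^sub>R x p) = (\<lambda>p. r *\<^sub>R dorfman z x p)"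
  by (simp add: dorfman_def br_scale_right pair_scale_right D_scale pair_smooth algebra_simps)

lemma act_pair_dorfman: "x \<in> \<Gamma> \<Longrightarrow> y \<in> \<Gamma> \<Longrightarrow> z \<in> \<Gamma> \<Longrightarrow>
    act x (pair y z) p = pair (dorfman x y) z p + pair y (dorfman x z) p"
  unfolding dorfman_def by (rule act_pair)

lemma dorfman_symmetrized:
  assumes "x \<in> \<Gamma>" "y \<in> \<Gamma>"
  shows "dorfman x y p = 2 *\<^sub>R \<D> (pair x y) p - dorfman y x p"
proof -
  have "pair y x = pair x y" using pair_sym[OF assms(2,1)] by blast
  moreover have "br x y p = - br y x p" using br_skew[OF assms] by simp
  ultimately show ?thesis by (simp add: dorfman_def scaleR_2)
qed

lemma dorfman_self: "x \<in> \<Gamma> \<Longrightarrow> dorfman x x = \<D> (pair x x)"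
proof
  fix p assume x: "x \<in> \<Gamma>"
  have "2 *\<^sub>R dorfman x x p = 2 *\<^sub>R \<D> (pair x x) p"
    using dorfman_symmetrized[OF x x, of p] by (simp add: scaleR_2 algebra_simps)
  then show "dorfman x x p = \<D> (pair x x) p" by simp
qed

text \<open>
  After pairing with \<open>z\<close>, the derivation rule for \<open>\<langle>\<D>f, z\<rangle>\<close> along \<open>x\<close> leaves
  \<open>1/2 (\<rho>(x) \<rho>(z) f - \<rho>(x \<cdot> z) f)\<close>.  Since the anchor kills \<open>\<D>\<langle>x, z\<rangle>\<close> and preserves
  brackets, this is \<open>1/2 \<rho>(z) \<rho>(x) f\<close>.
\<close>

lemma dorfman_D:
  assumes x: "x \<in> \<Gamma>" and f: "f \<in> smooth"
  shows "dorfman x (\<D> f) = \<D> (act x f)"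
proof (rule section_eqI)
  fix z p assume z: "z \<in> \<Gamma>"
  note Df = D_closed[OF f]
  have "act x (pair (\<D> f) z) p = 1/2 * act x (act z f) p"
  proof -
    have "pair (\<D> f) z = (\<lambda>p. 1/2 * act z f p)" using D_eq[OF f z] by blast
    then show ?thesis
      by (simp only: vector_field_apply_def[of _ _ "\<lambda>p. 1/2 * _ p"]
          tangent_apply_scale[OF act_smooth[OF f z]]) (simp add: vector_field_apply_def)
  qed
  moreover have "pair (\<D> f) (dorfman x z) p = 1/2 * (act x (act z f) p - act z (act x f) p)"
  proof -
    have "pair (\<D> f) (dorfman x z) p = pair (\<D> f) (br x z) p + pair (\<D> f) (\<D> (pair x z)) p"
      unfolding dorfman_def
      by (rule pair_add_right[OF br_closed[OF x z] D_closed[OF pair_smooth[OF x z]] Df])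
    also have "pair (\<D> f) (\<D> (pair x z)) p = 0"
      using D_eq[OF f D_closed] act_D[OF f] pair_smooth[OF x z] by simp
    also have "pair (\<D> f) (br x z) p = 1/2 * act (br x z) f p"
      by (rule D_eq[OF f br_closed[OF x z]])
    also have "act (br x z) f p = act x (act z f) p - act z (act x f) p"
      using anchor_br[OF x z] f unfolding is_vector_field_bracket_def by blast
    finally show ?thesis by simp
  qed
  moreover have "pair (\<D> (act x f)) z p = 1/2 * act z (act x f) p"
    by (rule D_eq[OF act_smooth[OF f x] z])
  ultimately show "pair (dorfman x (\<D> f)) z p = pair (\<D> (act x f)) z p"
    using act_pair_dorfman[OF x Df z, of p] by (simp add: algebra_simps)
qed (intro dorfman_closed D_closed act_smooth assms)+

text \<open>
  By the symmetrization formula \<open>\<D>f \<cdot> x + x \<cdot> \<D>f = 2 \<D>\<langle>x, \<D>f\<rangle> = \<D>(\<rho>(x) f)\<close>, and the second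
  summand alone already equals the right-hand side.
\<close>

lemma dorfman_D_left:
  assumes x: "x \<in> \<Gamma>" and f: "f \<in> smooth"
  shows "dorfman (\<D> f) x = (\<lambda>p. 0)"
proof
  fix p
  have "\<D> (act x f) p = 2 *\<^sub>R \<D> (pair (\<D> f) x) p"
    using D_scale[OF pair_smooth[OF D_closed[OF f] x], of 2] act_eq_pair[OF f x] by simp
  then show "dorfman (\<D> f) x p = 0"
    using dorfman_symmetrized[OF D_closed[OF f] x, of p] dorfman_D[OF x f] by simp
qed

lemma dorfman_diff_D_left:
  assumes "x \<in> \<Gamma>" "z \<in> \<Gamma>" "f \<in> smooth"
  shows "dorfman (\<lambda>p. r *\<^sub>R \<D> f p - x p) z = (\<lambda>p. - dorfman x z p)"
proof -
  have "(\<lambda>p. r *\<^sub>R \<D> f p - x p) = (\<lambda>p. r *\<^sub>R \<D> f p + (-1) *\<^sub>R x p)" by simp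
  moreover have "dorfman (\<lambda>p. r *\<^sub>R \<D> f p + (-1) *\<^sub>R x p) z = (\<lambda>p. - dorfman x z p)"
    by (subst dorfman_add_left)
      (simp_all add: assms section_scale D_closed dorfman_scale_left dorfman_D_left
        dorfman_scale_left[of x z "-1", simplified] section_scale[of x "-1", simplified])
  ultimately show ?thesis by simp
qed

lemma br_eq_dorfman: "br x y = (\<lambda>p. dorfman x y p - \<D> (pair x y) p)"
  by (simp add: dorfman_def)

lemma br_br:
  assumes "x \<in> \<Gamma>" "y \<in> \<Gamma>" "z \<in> \<Gamma>"
  shows "br (br x y) z p = dorfman (dorfman x y) z p - \<D> (pair (br x y) z) p"
proof -
  have "dorfman (\<lambda>p. 1 *\<^sub>R \<D> (pair x y) p - dorfman x y p) z = (\<lambda>p. - dorfman (dorfman x y) z p)"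
    by (intro dorfman_diff_D_left dorfman_closed pair_smooth assms)
  moreover have "(\<lambda>p. (-1) *\<^sub>R br x y p) = (\<lambda>p. 1 *\<^sub>R \<D> (pair x y) p - dorfman x y p)"
    by (simp add: br_eq_dorfman[of x y])
  ultimately have "dorfman (br x y) z p = dorfman (dorfman x y) z p"
    using dorfman_scale_left[OF br_closed[OF assms(1,2)] assms(3), of "-1"]
    by (metis neg_equal_iff_equal scaleR_minus1_left)
  then show ?thesis using br_eq_dorfman[of "br x y" z] by simp
qed

lemma pair_br:
  assumes "x \<in> \<Gamma>" "y \<in> \<Gamma>" "z \<in> \<Gamma>"
  shows "pair (br x y) z p = pair (dorfman x y) z p - 1/2 * act z (pair x y) p"
  using pair_add_left[OF br_closed[OF assms(1,2)] D_closed[OF pair_smooth[OF assms(1,2)]] assms(3), of p]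
    D_eq[OF pair_smooth[OF assms(1,2)] assms(3), of p]
  by (simp add: dorfman_def)

lemma pair_dorfman_symmetrized:
  assumes "x \<in> \<Gamma>" "y \<in> \<Gamma>" "z \<in> \<Gamma>"
  shows "pair (dorfman x y) z p + pair (dorfman y x) z p = act z (pair x y) p"
proof -
  have s: "pair y x = pair x y" using pair_sym[OF assms(2,1)] by blast
  have "pair (br x y) z p + pair (br y x) z p = 0"
    using br_skew[OF assms(1,2)] pair_scale_left[OF br_closed[OF assms(2,1)] assms(3), of p "-1"]
    by simp
  then show ?thesis using pair_br[OF assms, of p] pair_br[OF assms(2,1,3), of p] by (simp add: s)
qed

text \<open>
  With \<open>A = \<langle>x\<cdot>y, z\<rangle>\<close>, \<open>B = \<langle>y\<cdot>z, x\<rangle>\<close>, \<open>C = \<langle>z\<cdot>x, y\<rangle>\<close> and \<open>A'\<close>, \<open>B'\<close>, \<open>C'\<close> the same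
  with the factors of the product exchanged, \<open>\<rho>(x) \<langle>y, z\<rangle>\<close> equals both \<open>B + B'\<close> and \<open>A + C'\<close>, and
  similarly for the other two derivatives.  Hence \<open>6 T = A + B + C - A' - B' - C' = 3 B - 3 C'\<close>.
\<close>

lemma four_T_eq:
  assumes x: "x \<in> \<Gamma>" and y: "y \<in> \<Gamma>" and z: "z \<in> \<Gamma>"
  shows "4 * T x y z p = 2 * pair (dorfman y z) x p - 2 * pair (dorfman x z) y p"
proof -
  have s: "pair z x = pair x z" "pair z y = pair y z" "pair y x = pair x y"
    using pair_sym x y z by blast+
  note d = dorfman_closed
  show ?thesis
    using pair_br[OF x y z, of p] pair_br[OF y z x, of p] pair_br[OF z x y, of p]
      act_pair_dorfman[OF x y z, of p] act_pair_dorfman[OF y x z, of p] act_pair_dorfman[OF z x y, of p]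
      pair_dorfman_symmetrized[OF x y z, of p] pair_dorfman_symmetrized[OF y z x, of p]
      pair_dorfman_symmetrized[OF z x y, of p]
      pair_sym[OF y d[OF x z], of p] pair_sym[OF x d[OF y z], of p] pair_sym[OF x d[OF z y], of p]
    unfolding s by argo
qed

text \<open>
  The Jacobi anomaly \<open>\<D>T\<close> of the skew bracket is exactly what makes the non-skew product Leibniz.
  As left multiplication by a \<open>\<D>\<close>-term is zero, replacing brackets by products in the
  cyclic sum gives \<open>(x\<cdot>y)\<cdot>z + (y\<cdot>z)\<cdot>x + (z\<cdot>x)\<cdot>y = 4 \<D>T(x, y, z)\<close>.  Moving \<open>x\<close> and \<open>y\<close> to the
  left in the last two summands creates further \<open>\<D>\<close>-terms, which cancel \<open>4 \<D>T\<close> by the preceding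
  identity.
\<close>

lemma dorfman_leibniz:
  assumes x: "x \<in> \<Gamma>" and y: "y \<in> \<Gamma>" and z: "z \<in> \<Gamma>"
  shows "dorfman x (dorfman y z) = (\<lambda>p. dorfman (dorfman x y) z p + dorfman y (dorfman x z) p)"
proof
  fix p
  note c = br_closed dorfman_closed
  let ?a = "pair (br x y) z" and ?b = "pair (br y z) x" and ?c = "pair (br z x) y"
  have sm: "?a \<in> smooth" "?b \<in> smooth" "?c \<in> smooth"
    by (intro pair_smooth c x y z)+
  have T_smooth: "T x y z \<in> smooth"
    by (intro smooth_functions_scale smooth_functions_add sm)
  have "\<D> (\<lambda>p. 3 * T x y z p) p = \<D> ?a p + \<D> ?b p + \<D> ?c p"
  proof -
    have "(\<lambda>p. 3 * T x y z p) = (\<lambda>p. ?a p + ?b p + ?c p)"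
      by (rule ext) simp
    then show ?thesis
      using D_add[OF smooth_functions_add[OF sm(1,2)] sm(3)] D_add[OF sm(1,2)] by (simp only:)
  qed
  then have sumD: "\<D> ?a p + \<D> ?b p + \<D> ?c p = 3 *\<^sub>R \<D> (T x y z) p"
    using D_scale[OF T_smooth, of 3] by simp
  have "dorfman (dorfman x y) z p + dorfman (dorfman y z) x p + dorfman (dorfman z x) y p
      = \<D> (T x y z) p + (\<D> ?a p + \<D> ?b p + \<D> ?c p)"
    using jacobi[OF x y z, of p] br_br[OF x y z, of p] br_br[OF y z x, of p] br_br[OF z x y, of p]
    by (simp add: algebra_simps)
  also have "\<dots> = 4 *\<^sub>R \<D> (T x y z) p"
    unfolding sumD using scaleR_left_distrib[of 1 3 "\<D> (T x y z) p"] by simp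
  also have "\<dots> = \<D> (\<lambda>p. 2 * pair (dorfman y z) x p + (-2) * pair (dorfman x z) y p) p"
  proof -
    have "(\<lambda>p. 2 * pair (dorfman y z) x p + (-2) * pair (dorfman x z) y p) = (\<lambda>p. 4 * T x y z p)"
      unfolding four_T_eq[OF x y z] by simp
    then show ?thesis using D_scale[OF T_smooth, of 4] by simp
  qed
  also have "\<dots> = 2 *\<^sub>R \<D> (pair (dorfman y z) x) p - 2 *\<^sub>R \<D> (pair (dorfman x z) y) p"
    by (subst D_add) (auto intro!: smooth_functions_scale[of _ 2] smooth_functions_scale[of _ "-2", simplified]
        pair_smooth c x y z
        simp: D_scale[OF pair_smooth[OF dorfman_closed[OF y z] x], of 2]
         D_scale[OF pair_smooth[OF dorfman_closed[OF x z] y], of "-2", simplified])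
  finally have sum: "dorfman (dorfman x y) z p + dorfman (dorfman y z) x p + dorfman (dorfman z x) y p
      = 2 *\<^sub>R \<D> (pair (dorfman y z) x) p - 2 *\<^sub>R \<D> (pair (dorfman x z) y) p" .
  have 1: "dorfman (dorfman y z) x p = 2 *\<^sub>R \<D> (pair (dorfman y z) x) p - dorfman x (dorfman y z) p"
    by (rule dorfman_symmetrized[OF dorfman_closed[OF y z] x])
  have "dorfman (\<lambda>p. 2 *\<^sub>R \<D> (pair z x) p - dorfman x z p) y = (\<lambda>p. - dorfman (dorfman x z) y p)"
    by (intro dorfman_diff_D_left dorfman_closed pair_smooth x y z)
  moreover have "dorfman z x = (\<lambda>p. 2 *\<^sub>R \<D> (pair z x) p - dorfman x z p)"
    using dorfman_symmetrized[OF z x] by blast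
  ultimately have "dorfman (dorfman z x) y p = - dorfman (dorfman x z) y p" by metis
  moreover have "dorfman (dorfman x z) y p = 2 *\<^sub>R \<D> (pair (dorfman x z) y) p - dorfman y (dorfman x z) p"
    by (rule dorfman_symmetrized[OF dorfman_closed[OF x z] y])
  ultimately show "dorfman x (dorfman y z) p = dorfman (dorfman x y) z p + dorfman y (dorfman x z) p"
    using sum 1 by (simp add: algebra_simps)
qed

end

section \<open>Leibniz algebras and their quotients\<close>

lemma real_scalars_simps [simp]:
  "carrier real_scalars = UNIV" "a \<oplus>\<^bsub>real_scalars\<^esub> b = a + b" "a \<otimes>\<^bsub>real_scalars\<^esub> b = a * b"
  "\<zero>\<^bsub>real_scalars\<^esub> = 0" "\<one>\<^bsub>real_scalars\<^esub> = 1"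
  by (simp_all add: real_scalars_def)

lemma real_scalars_cring: "cring real_scalars"
proof (rule cringI)
  show "abelian_group real_scalars"
    by (rule abelian_groupI) (simp_all, metis add.left_inverse)
  show "comm_monoid real_scalars"
    by (rule comm_monoidI) auto
qed (simp add: distrib_right)

locale real_algebra = module real_scalars M for M :: "(real, 'a) module" (structure) +
  assumes mult_closed [simp, intro]: "x \<in> carrier M \<Longrightarrow> y \<in> carrier M \<Longrightarrow> x \<otimes> y \<in> carrier M"
    and mult_add_left: "x \<in> carrier M \<Longrightarrow> y \<in> carrier M \<Longrightarrow> z \<in> carrier M \<Longrightarrow>
      (x \<oplus> y) \<otimes> z = (x \<otimes> z) \<oplus> (y \<otimes> z)"
    and mult_add_right: "x \<in> carrier M \<Longrightarrow> y \<in> carrier M \<Longrightarrow> z \<in> carrier M \<Longrightarrow>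
      z \<otimes> (x \<oplus> y) = (z \<otimes> x) \<oplus> (z \<otimes> y)"
    and mult_smult_left: "x \<in> carrier M \<Longrightarrow> y \<in> carrier M \<Longrightarrow>
      (r \<odot> x) \<otimes> y = r \<odot> (x \<otimes> y)"
    and mult_smult_right: "x \<in> carrier M \<Longrightarrow> y \<in> carrier M \<Longrightarrow>
      x \<otimes> (r \<odot> y) = r \<odot> (x \<otimes> y)"

begin

lemma real_smult [simp]:
  shows real_smult_closed: "x \<in> carrier M \<Longrightarrow> r \<odot> x \<in> carrier M"
    and real_smult_one: "x \<in> carrier M \<Longrightarrow> 1 \<odot> x = x"
    and real_smult_zero: "x \<in> carrier M \<Longrightarrow> 0 \<odot> x = \<zero>"
    and real_smult_of_zero: "r \<odot> \<zero> = \<zero>"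
  using smult_closed[of r x] smult_one[of x] smult_l_null[of x] smult_r_null[of r]
  unfolding real_scalars_simps by blast+

lemma real_smult_distrib:
  shows real_smult_l_distr: "x \<in> carrier M \<Longrightarrow> (r + s) \<odot> x = (r \<odot> x) \<oplus> (s \<odot> x)"
    and real_smult_r_distr: "x \<in> carrier M \<Longrightarrow> y \<in> carrier M \<Longrightarrow>
      r \<odot> (x \<oplus> y) = (r \<odot> x) \<oplus> (r \<odot> y)"
    and real_smult_assoc: "x \<in> carrier M \<Longrightarrow> (r * s) \<odot> x = r \<odot> (s \<odot> x)"
  using smult_l_distr[of r s x] smult_r_distr[of r x y] smult_assoc1[of r s x]
  unfolding real_scalars_simps by blast+

lemma mult_zero_right [simp]: "x \<in> carrier M \<Longrightarrow> x \<otimes> \<zero> = \<zero>"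
  using mult_smult_right[of x \<zero> 0] by simp

lemma mult_minus_right: "x \<in> carrier M \<Longrightarrow> y \<in> carrier M \<Longrightarrow> x \<otimes> (\<ominus> y) = \<ominus> (x \<otimes> y)"
  using mult_add_right[of "\<ominus> y" y x] by (intro M.minus_equality[symmetric]) (simp_all add: M.l_neg)

lemma smult_minus: "x \<in> carrier M \<Longrightarrow> r \<odot> (\<ominus> x) = \<ominus> (r \<odot> x)"
  using smult_r_minus[of r x] by simp

end

lemma nonassoc_algebra_iff: "nonassoc_algebra M \<longleftrightarrow> real_algebra M"
  unfolding nonassoc_algebra_def real_algebra_def real_algebra_axioms_def
  by (intro iffI conjI allI ballI; elim conjE; simp)

lemma nonassoc_algebraI:
  fixes M (structure)
  assumes "\<And>x y. x \<in> carrier M \<Longrightarrow> y \<in> carrier M \<Longrightarrow> x \<oplus> y \<in> carrier M"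
    and "\<zero> \<in> carrier M"
    and "\<And>x y z. x \<in> carrier M \<Longrightarrow> y \<in> carrier M \<Longrightarrow> z \<in> carrier M \<Longrightarrow> (x \<oplus> y) \<oplus> z = x \<oplus> (y \<oplus> z)"
    and "\<And>x y. x \<in> carrier M \<Longrightarrow> y \<in> carrier M \<Longrightarrow> x \<oplus> y = y \<oplus> x"
    and "\<And>x. x \<in> carrier M \<Longrightarrow> \<zero> \<oplus> x = x"
    and "\<And>x. x \<in> carrier M \<Longrightarrow> \<exists>y\<in>carrier M. y \<oplus> x = \<zero>"
    and "\<And>r x. x \<in> carrier M \<Longrightarrow> r \<odot> x \<in> carrier M"
    and "\<And>r s x. x \<in> carrier M \<Longrightarrow> (r + s) \<odot> x = (r \<odot> x) \<oplus> (s \<odot> x)"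
    and "\<And>r x y. x \<in> carrier M \<Longrightarrow> y \<in> carrier M \<Longrightarrow> r \<odot> (x \<oplus> y) = (r \<odot> x) \<oplus> (r \<odot> y)"
    and "\<And>r s x. x \<in> carrier M \<Longrightarrow> (r * s) \<odot> x = r \<odot> (s \<odot> x)"
    and "\<And>x. x \<in> carrier M \<Longrightarrow> 1 \<odot> x = x"
    and "\<And>x y. x \<in> carrier M \<Longrightarrow> y \<in> carrier M \<Longrightarrow> x \<otimes> y \<in> carrier M"
    and "\<And>x y z. x \<in> carrier M \<Longrightarrow> y \<in> carrier M \<Longrightarrow> z \<in> carrier M \<Longrightarrow>
      (x \<oplus> y) \<otimes> z = (x \<otimes> z) \<oplus> (y \<otimes> z)"
    and "\<And>x y z. x \<in> carrier M \<Longrightarrow> y \<in> carrier M \<Longrightarrow> z \<in> carrier M \<Longrightarrow>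
      z \<otimes> (x \<oplus> y) = (z \<otimes> x) \<oplus> (z \<otimes> y)"
    and "\<And>r x y. x \<in> carrier M \<Longrightarrow> y \<in> carrier M \<Longrightarrow> (r \<odot> x) \<otimes> y = r \<odot> (x \<otimes> y)"
    and "\<And>r x y. x \<in> carrier M \<Longrightarrow> y \<in> carrier M \<Longrightarrow> x \<otimes> (r \<odot> y) = r \<odot> (x \<otimes> y)"
  shows "nonassoc_algebra M"
proof -
  have "Module.module real_scalars M"
    by (rule moduleI[OF real_scalars_cring abelian_groupI[OF assms(1-6)]]) (simp_all add: assms(7-11))
  then show ?thesis
    unfolding nonassoc_algebra_def by (intro conjI ballI allI assms(12-16))
qed

locale leibniz = real_algebra +
  assumes leibniz_identity: "x \<in> carrier M \<Longrightarrow> y \<in> carrier M \<Longrightarrow> z \<in> carrier M \<Longrightarrow>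
    x \<otimes> (y \<otimes> z) = ((x \<otimes> y) \<otimes> z) \<oplus> (y \<otimes> (x \<otimes> z))"

lemma leibniz_algebra_iff: "leibniz_algebra M \<longleftrightarrow> leibniz M"
  unfolding leibniz_algebra_def leibniz_def leibniz_axioms_def nonassoc_algebra_iff Ball_def by (rule conj_cong[OF refl]) (rule iffI; iprover)

text \<open>
  For a skew product the Leibniz identity is a form of the Jacobi identity.
\<close>

lemma (in leibniz) lie_algebra_if_alternating:
  assumes sq: "\<And>x. x \<in> carrier M \<Longrightarrow> x \<otimes> x = \<zero>"
  shows "lie_algebra M"
proof -
  have skew: "y \<otimes> x = \<ominus> (x \<otimes> y)" if "x \<in> carrier M" "y \<in> carrier M" for x y
  proof -
    have "(y \<otimes> x) \<oplus> (x \<otimes> y) = (x \<oplus> y) \<otimes> (x \<oplus> y)"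
      using that by (simp add: mult_add_left mult_add_right sq[OF that(1)] sq[OF that(2)])
    also have "\<dots> = \<zero>" using that by (intro sq) simp
    finally have "(y \<otimes> x) \<oplus> (x \<otimes> y) = \<zero>" .
    then show ?thesis using that by (intro M.minus_equality[symmetric]) simp_all
  qed
  have "((x \<otimes> y) \<otimes> z) \<oplus> ((y \<otimes> z) \<otimes> x) \<oplus> ((z \<otimes> x) \<otimes> y) = \<zero>"
    if "x \<in> carrier M" "y \<in> carrier M" "z \<in> carrier M" for x y z
  proof -
    have "(y \<otimes> z) \<otimes> x = \<ominus> (((x \<otimes> y) \<otimes> z) \<oplus> (y \<otimes> (x \<otimes> z)))"
      using that skew[of x "y \<otimes> z"] leibniz_identity[of x y z] by simp
    moreover have "(z \<otimes> x) \<otimes> y = y \<otimes> (x \<otimes> z)"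
      using that skew[of y "z \<otimes> x"] skew[of x z] by (simp add: mult_minus_right)
    moreover have "((x \<otimes> y) \<otimes> z) \<oplus> \<ominus> (((x \<otimes> y) \<otimes> z) \<oplus> (y \<otimes> (x \<otimes> z))) \<oplus> (y \<otimes> (x \<otimes> z)) = \<zero>"
      using that by (simp add: M.minus_add M.a_assoc M.r_neg1 M.r_neg M.l_neg M.r_neg2)
    ultimately show ?thesis by simp
  qed
  then show ?thesis
    unfolding lie_algebra_def nonassoc_algebra_iff
    by (intro conjI ballI real_algebra_axioms sq)
qed

lemma leibniz_algebra_image:
  fixes M (structure) and N
  assumes "leibniz_algebra M" and carrier: "carrier N = q ` carrier M"
    and add: "\<And>x y. x \<in> carrier M \<Longrightarrow> y \<in> carrier M \<Longrightarrow> q x \<oplus>\<^bsub>N\<^esub> q y = q (x \<oplus> y)"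
    and zero: "\<zero>\<^bsub>N\<^esub> = q \<zero>"
    and smult: "\<And>r x. x \<in> carrier M \<Longrightarrow> r \<odot>\<^bsub>N\<^esub> q x = q (r \<odot> x)"
    and mult: "\<And>x y. x \<in> carrier M \<Longrightarrow> y \<in> carrier M \<Longrightarrow> q x \<otimes>\<^bsub>N\<^esub> q y = q (x \<otimes> y)"
  shows "leibniz_algebra N"
proof -
  interpret leibniz M using assms(1) by (simp add: leibniz_algebra_iff)
  note rules = add zero smult mult
  have "nonassoc_algebra N"
  proof (rule nonassoc_algebraI, unfold carrier, goal_cases)
    case (4 x y)
    then obtain a b where "a \<in> carrier M" "b \<in> carrier M" "x = q a" "y = q b" by blast
    then show ?case using add M.a_comm by metis
  next
    case (6 x)
    then obtain a where a: "a \<in> carrier M" "x = q a" by blast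
    then show ?case by (intro bexI[of _ "q (\<ominus> a)"]) (simp_all add: rules M.l_neg)
  qed ((elim imageE)?;
      simp add: imageI rules M.a_assoc real_smult_distrib mult_add_left mult_add_right
        mult_smult_left mult_smult_right)+
  moreover have "q x \<otimes>\<^bsub>N\<^esub> (q y \<otimes>\<^bsub>N\<^esub> q z) =
      ((q x \<otimes>\<^bsub>N\<^esub> q y) \<otimes>\<^bsub>N\<^esub> q z) \<oplus>\<^bsub>N\<^esub> (q y \<otimes>\<^bsub>N\<^esub> (q x \<otimes>\<^bsub>N\<^esub> q z))"
    if "x \<in> carrier M" "y \<in> carrier M" "z \<in> carrier M" for x y z
    using that leibniz_identity[of x y z] by (simp add: rules)
  ultimately show ?thesis
    unfolding leibniz_algebra_def carrier by (intro conjI ballI; (elim imageE, hypsubst)?) blast+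
qed


text \<open>
  The product is not associative, so these are not facts about quotient rings.  They hold because
  other representatives change a product \<open>x \<otimes> y\<close> by \<open>i \<otimes> j\<close>, \<open>x \<otimes> j\<close> and \<open>i \<otimes> y\<close>, all in \<open>I\<close>.
\<close>

lemma (in leibniz) quotient_algebra_ops:
  assumes I: "two_sided_ideal I M"
  defines "q \<equiv> coset_map M I"
  shows "carrier (quotient_algebra M I) = q ` carrier M"
    and "\<zero>\<^bsub>quotient_algebra M I\<^esub> = q \<zero>"
    and "x \<in> carrier M \<Longrightarrow> y \<in> carrier M \<Longrightarrow> q x \<oplus>\<^bsub>quotient_algebra M I\<^esub> q y = q (x \<oplus> y)"
    and "x \<in> carrier M \<Longrightarrow> y \<in> carrier M \<Longrightarrow> q x \<otimes>\<^bsub>quotient_algebra M I\<^esub> q y = q (x \<otimes> y)"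
    and "x \<in> carrier M \<Longrightarrow> r \<odot>\<^bsub>quotient_algebra M I\<^esub> q x = q (r \<odot> x)"
    and "i \<in> I \<Longrightarrow> q i = q \<zero>"
    and "\<And>x a. x \<in> carrier M \<Longrightarrow> a \<in> q x \<Longrightarrow> \<exists>i\<in>I. a = i \<oplus> x"
    and "\<And>x. x \<in> carrier M \<Longrightarrow> x \<in> q x"
proof -
  have sm: "submodule I real_scalars M"
    and ideal: "\<And>x i. x \<in> carrier M \<Longrightarrow> i \<in> I \<Longrightarrow> x \<otimes> i \<in> I"
      "\<And>x i. x \<in> carrier M \<Longrightarrow> i \<in> I \<Longrightarrow> i \<otimes> x \<in> I"
    using I unfolding two_sided_ideal_def by blast+
  have sg: "subgroup I (add_monoid M)" using sm by (rule submodule.axioms(1))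
  interpret S: abelian_subgroup I M
    by (rule abelian_subgroupI3[OF additive_subgroup.intro[OF sg] M.abelian_group_axioms])
  have sub: "I \<subseteq> carrier M" by (rule S.a_subset)
  have Iadd: "i \<oplus> j \<in> I" if "i \<in> I" "j \<in> I" for i j using submoduleE(5)[OF sm] that by blast
  have Ismult: "r \<odot> i \<in> I" if "i \<in> I" for r i using submoduleE(4)[OF sm] that by simp
  have rep: "q (i \<oplus> x) = q x" if "i \<in> I" "x \<in> carrier M" for i x
    unfolding q_def coset_map_def
    using M.a_repr_independence[OF M.a_rcosI[OF that(1) sub that(2)] that(2) sg] by simp
  have mem: "\<exists>i\<in>I. a = i \<oplus> x" if "a \<in> q x" for a x
    using that unfolding q_def coset_map_def a_r_coset_def' by blast
  have self: "x \<in> q x" if "x \<in> carrier M" for x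
    using S.a_rcos_self[OF that] by (simp add: q_def coset_map_def)
  show "carrier (quotient_algebra M I) = q ` carrier M"
    by (auto simp: quotient_algebra_def ring.defs FactRing_def A_RCOSETS_def' q_def coset_map_def)
  show "\<zero>\<^bsub>quotient_algebra M I\<^esub> = q \<zero>"
    using sub by (simp add: quotient_algebra_def ring.defs FactRing_def q_def coset_map_def)
  show "i \<in> I \<Longrightarrow> q i = q \<zero>" using rep[of i \<zero>] sub by auto
  show "\<exists>i\<in>I. a = i \<oplus> x" if "x \<in> carrier M" "a \<in> q x" for x a
    using mem that by blast
  show "x \<in> q x" if "x \<in> carrier M" for x using self that .
  show "q x \<oplus>\<^bsub>quotient_algebra M I\<^esub> q y = q (x \<oplus> y)" if "x \<in> carrier M" "y \<in> carrier M"
    using S.a_rcos_sum[OF that]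
    by (simp add: quotient_algebra_def ring.defs FactRing_def q_def coset_map_def)
  show "q x \<otimes>\<^bsub>quotient_algebra M I\<^esub> q y = q (x \<otimes> y)" if xy: "x \<in> carrier M" "y \<in> carrier M"
  proof -
    have "q (a \<otimes> b) = q (x \<otimes> y)" if ab: "a \<in> q x" "b \<in> q y" for a b
    proof -
      obtain i j where ij: "i \<in> I" "a = i \<oplus> x" "j \<in> I" "b = j \<oplus> y"
        using mem ab by metis
      then have c: "i \<in> carrier M" "j \<in> carrier M" using sub by blast+
      have "a \<otimes> b = ((i \<otimes> j) \<oplus> (x \<otimes> j) \<oplus> (i \<otimes> y)) \<oplus> (x \<otimes> y)"
        using c xy ij by (simp add: mult_add_left mult_add_right M.a_assoc)
      moreover have "(i \<otimes> j) \<oplus> (x \<otimes> j) \<oplus> (i \<otimes> y) \<in> I"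
        using ij xy c by (intro Iadd ideal)
      ultimately show ?thesis using rep xy by simp
    qed
    then have "(\<Union>a\<in>q x. \<Union>b\<in>q y. q (a \<otimes> b)) = q (x \<otimes> y)"
      using self xy by blast
    then show ?thesis
      by (simp add: quotient_algebra_def ring.defs FactRing_def rcoset_mult_def q_def coset_map_def)
  qed
  show "r \<odot>\<^bsub>quotient_algebra M I\<^esub> q x = q (r \<odot> x)" if x: "x \<in> carrier M"
  proof -
    have "q (r \<odot> a) = q (r \<odot> x)" if a: "a \<in> q x" for a
    proof -
      obtain i where i: "i \<in> I" "a = i \<oplus> x" using mem a by blast
      then have "r \<odot> a = (r \<odot> i) \<oplus> (r \<odot> x)" using sub x by (auto simp: real_smult_distrib)
      then show ?thesis using rep Ismult i x by simp
    qed
    then have "(\<Union>a\<in>q x. q (r \<odot> a)) = q (r \<odot> x)" using self x by blast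
    then show ?thesis
      by (simp add: quotient_algebra_def ring.defs FactRing_def q_def coset_map_def)
  qed
qed

section \<open>Semidirect products and enveloping Lie algebras\<close>

lemma lie_action:
  assumes "lie_hom H (derivation_algebra M) act"
  shows lie_action_closed: "h \<in> carrier H \<Longrightarrow> x \<in> carrier M \<Longrightarrow> act h x \<in> carrier M"
    and lie_action_add_right: "h \<in> carrier H \<Longrightarrow> x \<in> carrier M \<Longrightarrow> y \<in> carrier M \<Longrightarrow>
      act h (x \<oplus>\<^bsub>M\<^esub> y) = act h x \<oplus>\<^bsub>M\<^esub> act h y"
    and lie_action_smult_right: "h \<in> carrier H \<Longrightarrow> x \<in> carrier M \<Longrightarrow>
      act h (r \<odot>\<^bsub>M\<^esub> x) = r \<odot>\<^bsub>M\<^esub> act h x"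
    and lie_action_add_left: "h \<in> carrier H \<Longrightarrow> k \<in> carrier H \<Longrightarrow> x \<in> carrier M \<Longrightarrow>
      act (h \<oplus>\<^bsub>H\<^esub> k) x = act h x \<oplus>\<^bsub>M\<^esub> act k x"
    and lie_action_smult_left: "h \<in> carrier H \<Longrightarrow> x \<in> carrier M \<Longrightarrow>
      act (r \<odot>\<^bsub>H\<^esub> h) x = r \<odot>\<^bsub>M\<^esub> act h x"
    and lie_action_bracket: "h \<in> carrier H \<Longrightarrow> k \<in> carrier H \<Longrightarrow> x \<in> carrier M \<Longrightarrow>
      act (h \<otimes>\<^bsub>H\<^esub> k) x = act h (act k x) \<ominus>\<^bsub>M\<^esub> act k (act h x)"
proof -
  have der: "linear_hom M M (act h)" if "h \<in> carrier H" for h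
    using assms that by (auto simp: lie_hom_def linear_hom_def[of H] derivation_algebra_def)
  show "h \<in> carrier H \<Longrightarrow> x \<in> carrier M \<Longrightarrow> act h x \<in> carrier M"
    and "h \<in> carrier H \<Longrightarrow> x \<in> carrier M \<Longrightarrow> y \<in> carrier M \<Longrightarrow>
      act h (x \<oplus>\<^bsub>M\<^esub> y) = act h x \<oplus>\<^bsub>M\<^esub> act h y"
    and "h \<in> carrier H \<Longrightarrow> x \<in> carrier M \<Longrightarrow> act h (r \<odot>\<^bsub>M\<^esub> x) = r \<odot>\<^bsub>M\<^esub> act h x"
    using der unfolding linear_hom_def by blast+
  show "h \<in> carrier H \<Longrightarrow> k \<in> carrier H \<Longrightarrow> x \<in> carrier M \<Longrightarrow>
      act (h \<oplus>\<^bsub>H\<^esub> k) x = act h x \<oplus>\<^bsub>M\<^esub> act k x"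
    and "h \<in> carrier H \<Longrightarrow> x \<in> carrier M \<Longrightarrow> act (r \<odot>\<^bsub>H\<^esub> h) x = r \<odot>\<^bsub>M\<^esub> act h x"
    and "h \<in> carrier H \<Longrightarrow> k \<in> carrier H \<Longrightarrow> x \<in> carrier M \<Longrightarrow>
      act (h \<otimes>\<^bsub>H\<^esub> k) x = act h (act k x) \<ominus>\<^bsub>M\<^esub> act k (act h x)"
    using assms by (simp_all add: lie_hom_def linear_hom_def[of H] derivation_algebra_def)
qed

context real_algebra
begin

lemma minus_eq_smult: "x \<in> carrier M \<Longrightarrow> \<ominus> x = (-1) \<odot> x"
  using real_smult_l_distr[of x "-1" 1] by (intro M.minus_equality) simp_all

lemma submodule_if_closed:
  assumes "S \<subseteq> carrier M" "\<zero> \<in> S"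
    and "\<And>x y. x \<in> S \<Longrightarrow> y \<in> S \<Longrightarrow> x \<oplus> y \<in> S"
    and "\<And>r x. x \<in> S \<Longrightarrow> r \<odot> x \<in> S"
  shows "submodule S real_scalars M"
  using assms minus_eq_smult by (intro submoduleI) auto

lemma minus_diff: "a \<in> carrier M \<Longrightarrow> b \<in> carrier M \<Longrightarrow> c \<in> carrier M \<Longrightarrow> d \<in> carrier M \<Longrightarrow>
    (a \<oplus> b) \<ominus> (c \<oplus> d) = (a \<ominus> c) \<oplus> (b \<ominus> d)"
  by (simp add: a_minus_def M.minus_add M.a_ac)

lemma smult_diff: "a \<in> carrier M \<Longrightarrow> b \<in> carrier M \<Longrightarrow> r \<odot> (a \<ominus> b) = (r \<odot> a) \<ominus> (r \<odot> b)"
  by (simp add: a_minus_def real_smult_distrib smult_minus)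

text \<open>
  The second component of the Jacobi identity in a semidirect product, with
  \<open>a = h(kz)\<close>, \<open>b = k(hz)\<close>, \<open>c = l(hy)\<close>, \<open>d = l(kx)\<close>, \<open>e = k(lx)\<close>, \<open>f = h(ly)\<close>: each occurs
  once with either sign.
\<close>

lemma commutator_cyclic_sum:
  assumes "a \<in> carrier M" "b \<in> carrier M" "c \<in> carrier M" "d \<in> carrier M" "e \<in> carrier M" "f \<in> carrier M"
  shows "((a \<ominus> b) \<ominus> (c \<ominus> d)) \<oplus> ((e \<ominus> d) \<ominus> (a \<ominus> f)) \<oplus> ((c \<ominus> f) \<ominus> (e \<ominus> b)) = \<zero>"
proof -
  let ?s = "a \<oplus> b \<oplus> c \<oplus> d \<oplus> e \<oplus> f"
  have "((a \<ominus> b) \<ominus> (c \<ominus> d)) \<oplus> ((e \<ominus> d) \<ominus> (a \<ominus> f)) \<oplus> ((c \<ominus> f) \<ominus> (e \<ominus> b)) = ?s \<oplus> \<ominus> ?s"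
    using assms by (simp add: a_minus_def M.minus_add M.a_ac)
  then show ?thesis using assms by (simp add: M.r_neg)
qed

end

lemma semidirect_product_simps:
  "carrier (semidirect_product H M act) = carrier H \<times> carrier M"
  "(h, x) \<otimes>\<^bsub>semidirect_product H M act\<^esub> (k, y) = (h \<otimes>\<^bsub>H\<^esub> k, act h y \<ominus>\<^bsub>M\<^esub> act k x)"
  "(h, x) \<oplus>\<^bsub>semidirect_product H M act\<^esub> (k, y) = (h \<oplus>\<^bsub>H\<^esub> k, x \<oplus>\<^bsub>M\<^esub> y)"
  "r \<odot>\<^bsub>semidirect_product H M act\<^esub> (h, x) = (r \<odot>\<^bsub>H\<^esub> h, r \<odot>\<^bsub>M\<^esub> x)"
  "\<zero>\<^bsub>semidirect_product H M act\<^esub> = (\<zero>\<^bsub>H\<^esub>, \<zero>\<^bsub>M\<^esub>)"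
  by (simp_all add: semidirect_product_def)

lemma lie_algebra_semidirect_product:
  assumes H: "lie_algebra H" and M: "nonassoc_algebra M"
    and act: "lie_hom H (derivation_algebra M) act"
  shows "lie_algebra (semidirect_product H M act)"
proof -
  interpret H: real_algebra H using H by (simp add: lie_algebra_def nonassoc_algebra_iff)
  interpret M: real_algebra M using M by (simp add: nonassoc_algebra_iff)
  let ?G = "semidirect_product H M act"
  have sq: "h \<otimes>\<^bsub>H\<^esub> h = \<zero>\<^bsub>H\<^esub>" if "h \<in> carrier H" for h
    using H that by (simp add: lie_algebra_def)
  have jac: "((h \<otimes>\<^bsub>H\<^esub> k) \<otimes>\<^bsub>H\<^esub> l) \<oplus>\<^bsub>H\<^esub> ((k \<otimes>\<^bsub>H\<^esub> l) \<otimes>\<^bsub>H\<^esub> h) \<oplus>\<^bsub>H\<^esub> ((l \<otimes>\<^bsub>H\<^esub> h) \<otimes>\<^bsub>H\<^esub> k) = \<zero>\<^bsub>H\<^esub>"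
    if "h \<in> carrier H" "k \<in> carrier H" "l \<in> carrier H" for h k l
    using H that by (simp add: lie_algebra_def)
  have act_minus: "act h (\<ominus>\<^bsub>M\<^esub> x) = \<ominus>\<^bsub>M\<^esub> act h x" if "h \<in> carrier H" "x \<in> carrier M" for h x
    using that lie_action_smult_right[OF act that, of "-1"]
    by (simp add: M.minus_eq_smult lie_action_closed[OF act])
  have act_diff: "act h (x \<ominus>\<^bsub>M\<^esub> y) = act h x \<ominus>\<^bsub>M\<^esub> act h y"
    if "h \<in> carrier H" "x \<in> carrier M" "y \<in> carrier M" for h x y
    using that by (simp add: a_minus_def lie_action_add_right[OF act] act_minus)
  note rules = semidirect_product_simps lie_action_closed[OF act] lie_action_add_left[OF act]
    lie_action_add_right[OF act] lie_action_smult_left[OF act] lie_action_smult_right[OF act]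
    H.real_smult_distrib M.real_smult_distrib H.mult_add_left H.mult_add_right
    H.mult_smult_left H.mult_smult_right M.minus_diff M.smult_diff
  have "nonassoc_algebra ?G"
  proof (rule nonassoc_algebraI, unfold semidirect_product_simps, goal_cases)
    case (6 u)
    then show ?case
      by (intro bexI[of _ "(\<ominus>\<^bsub>H\<^esub> fst u, \<ominus>\<^bsub>M\<^esub> snd u)"])
        (auto simp: rules H.M.l_neg M.M.l_neg)
  next
    case (4 u v)
    then show ?case using H.M.a_comm M.M.a_comm by (cases u; cases v) (auto simp: semidirect_product_simps)
  qed (clarsimp simp: rules H.M.a_assoc M.M.a_assoc)+
  moreover have "u \<otimes>\<^bsub>?G\<^esub> u = \<zero>\<^bsub>?G\<^esub>" if "u \<in> carrier ?G" for u
    using that by (cases u) (simp add: rules sq a_minus_def M.M.r_neg)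
  moreover have "((u \<otimes>\<^bsub>?G\<^esub> v) \<otimes>\<^bsub>?G\<^esub> w) \<oplus>\<^bsub>?G\<^esub> ((v \<otimes>\<^bsub>?G\<^esub> w) \<otimes>\<^bsub>?G\<^esub> u) \<oplus>\<^bsub>?G\<^esub> ((w \<otimes>\<^bsub>?G\<^esub> u) \<otimes>\<^bsub>?G\<^esub> v) = \<zero>\<^bsub>?G\<^esub>"
    if "u \<in> carrier ?G" "v \<in> carrier ?G" "w \<in> carrier ?G" for u v w
  proof -
    obtain h x k y l z where uvw: "u = (h, x)" "v = (k, y)" "w = (l, z)"
      by (metis surj_pair)
    then have c: "h \<in> carrier H" "k \<in> carrier H" "l \<in> carrier H"
      "x \<in> carrier M" "y \<in> carrier M" "z \<in> carrier M"
      using that by (auto simp: semidirect_product_simps)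
    then show ?thesis
      using jac[OF c(1-3)] M.commutator_cyclic_sum[of "act h (act k z)" "act k (act h z)"
          "act l (act h y)" "act l (act k x)" "act k (act l x)" "act h (act l y)"]
      by (simp add: uvw semidirect_product_simps lie_action_closed[OF act]
          lie_action_bracket[OF act] act_diff)
  qed
  ultimately show ?thesis unfolding lie_algebra_def by blast
qed

context leibniz
begin

lemma left_mult_in_derivation_algebra:
  assumes "x \<in> carrier M"
  shows "left_mult M x \<in> carrier (derivation_algebra M)"
  using assms leibniz_identity[OF assms]
  by (simp add: derivation_algebra_def left_mult_def linear_hom_def mult_add_right mult_smult_right)

lemma left_mult_kernel_mult:
  "i \<in> left_mult_kernel M \<Longrightarrow> x \<in> carrier M \<Longrightarrow> i \<otimes> x = \<zero>"
  unfolding left_mult_kernel_def left_mult_def derivation_algebra_def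
  by (auto dest: fun_cong[of _ _ x])

context
  fixes I :: "'a set"
  assumes I: "two_sided_ideal I M"
    and squares: "\<And>x. x \<in> carrier M \<Longrightarrow> x \<otimes> x \<in> I"
    and kernel: "I \<subseteq> left_mult_kernel M"
begin

text \<open>
  Squares lie in \<open>I\<close>, so the product of the quotient is alternating.
\<close>

lemma quotient_lie_algebra: "lie_algebra (quotient_algebra M I)"
proof -
  note ops = quotient_algebra_ops[OF I]
  interpret H: leibniz "quotient_algebra M I"
    unfolding leibniz_algebra_iff[symmetric]
    using leibniz_axioms ops(1-5)
    by (intro leibniz_algebra_image[of M _ "coset_map M I"]) (simp_all add: leibniz_algebra_iff)
  show ?thesis
    by (rule H.lie_algebra_if_alternating) (auto simp: ops squares)
qed

lemma quotient_action_coset_map: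
  assumes x: "x \<in> carrier M"
  shows "quotient_action M (coset_map M I x) = left_mult M x"
proof -
  have "left_mult M a = left_mult M x" if a: "a \<in> coset_map M I x" for a
  proof -
    obtain i where i: "i \<in> I" "a = i \<oplus> x" using quotient_algebra_ops(7)[OF I x a] by blast
    then have "i \<in> carrier M" using kernel by (auto simp: left_mult_kernel_def)
    then show ?thesis
      using i x kernel left_mult_kernel_mult[of i]
      by (auto simp: left_mult_def mult_add_left intro!: restrict_ext)
  qed
  moreover have "x \<in> coset_map M I x" using quotient_algebra_ops(8)[OF I x] .
  ultimately show ?thesis unfolding quotient_action_def by (intro the_equality) (blast | metis)+
qed

text \<open>
  The Leibniz identity, read as \<open>\<lambda>(x \<cdot> y) = \<lambda>(x) \<lambda>(y) - \<lambda>(y) \<lambda>(x)\<close>, says that left multiplication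
  is a representation; read as \<open>x \<cdot> (y \<cdot> z) = (x \<cdot> y) \<cdot> z + y \<cdot> (x \<cdot> z)\<close>, that it acts by
  derivations.  It descends to the quotient because \<open>I\<close> acts trivially.
\<close>

lemma enveloping_quotient:
  defines "H \<equiv> quotient_algebra M I"
  shows "enveloping_lie_algebra (semidirect_product H M (quotient_action M)) H
    (quotient_action M) (coset_map M I) M"
proof -
  note ops = quotient_algebra_ops[OF I, folded H_def]
  have act: "quotient_action M (coset_map M I x) = left_mult M x" if "x \<in> carrier M" for x
    using quotient_action_coset_map that .
  have lie: "lie_algebra H" unfolding H_def by (rule quotient_lie_algebra)
  have hom: "lie_hom H (derivation_algebra M) (quotient_action M)"
    unfolding lie_hom_def linear_hom_def
  proof (intro conjI ballI allI funcsetI; unfold ops(1); elim imageE, hypsubst)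
    fix x assume x: "x \<in> carrier M"
    show "quotient_action M (coset_map M I x) \<in> carrier (derivation_algebra M)"
      using left_mult_in_derivation_algebra act x by simp
    show "quotient_action M (r \<odot>\<^bsub>H\<^esub> coset_map M I x)
        = r \<odot>\<^bsub>derivation_algebra M\<^esub> quotient_action M (coset_map M I x)" for r
      using x by (simp add: ops(5) act derivation_algebra_def left_mult_def mult_smult_left cong: restrict_cong)
    fix y assume y: "y \<in> carrier M"
    show "quotient_action M (coset_map M I x \<oplus>\<^bsub>H\<^esub> coset_map M I y) =
        quotient_action M (coset_map M I x) \<oplus>\<^bsub>derivation_algebra M\<^esub> quotient_action M (coset_map M I y)"
      using x y by (simp add: ops(3) act derivation_algebra_def left_mult_def mult_add_left cong: restrict_cong)
    have "(x \<otimes> y) \<otimes> z = x \<otimes> (y \<otimes> z) \<ominus> y \<otimes> (x \<otimes> z)" if z: "z \<in> carrier M" for z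
      using x y z by (simp add: leibniz_identity[of x y z] a_minus_def M.a_assoc M.r_neg)
    then show "quotient_action M (coset_map M I x \<otimes>\<^bsub>H\<^esub> coset_map M I y) =
        quotient_action M (coset_map M I x) \<otimes>\<^bsub>derivation_algebra M\<^esub> quotient_action M (coset_map M I y)"
      using x y by (simp add: ops(4) act derivation_algebra_def left_mult_def cong: restrict_cong)
  qed
  have "lie_algebra (semidirect_product H M (quotient_action M))"
    by (rule lie_algebra_semidirect_product[OF lie _ hom])
      (simp add: nonassoc_algebra_iff real_algebra_axioms)
  then show ?thesis
    unfolding enveloping_lie_algebra_def
    using leibniz_axioms lie hom
    by (auto simp: leibniz_algebra_iff linear_hom_def ops act left_mult_def)
qed

end

end

text \<open>
  Any linear map \<open>f\<close> from \<open>M\<close> to \<open>H\<close> will do: \<open>(h, x) = (f x, x) + (h - f x, 0)\<close> is the only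
  decomposition, so the projection remembers just the second component.
\<close>

lemma graph_complementary:
  assumes H: "nonassoc_algebra H" and M: "nonassoc_algebra M" and f: "linear_hom M H f"
    and G: "nonassoc_algebra (semidirect_product H M act)"
  defines "graph \<equiv> (\<lambda>x. (f x, x)) ` carrier M"
    and "N \<equiv> carrier H \<times> {\<zero>\<^bsub>M\<^esub>}"
  shows "complementary (semidirect_product H M act) graph N"
    and "h \<in> carrier H \<Longrightarrow> x \<in> carrier M \<Longrightarrow>
      projection_along (semidirect_product H M act) graph N (h, x) = (f x, x)"
proof -
  interpret H: real_algebra H using H by (simp add: nonassoc_algebra_iff)
  interpret M: real_algebra M using M by (simp add: nonassoc_algebra_iff)
  let ?G = "semidirect_product H M act"
  interpret G: real_algebra ?G using G by (simp add: nonassoc_algebra_iff)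
  have f_closed: "f x \<in> carrier H" if "x \<in> carrier M" for x
    using f that by (auto simp: linear_hom_def)
  have f_add: "f (x \<oplus>\<^bsub>M\<^esub> y) = f x \<oplus>\<^bsub>H\<^esub> f y" if "x \<in> carrier M" "y \<in> carrier M" for x y
    using f that by (auto simp: linear_hom_def)
  have f_smult: "f (r \<odot>\<^bsub>M\<^esub> x) = r \<odot>\<^bsub>H\<^esub> f x" if "x \<in> carrier M" for r x
    using f that by (auto simp: linear_hom_def)
  have f_zero: "f \<zero>\<^bsub>M\<^esub> = \<zero>\<^bsub>H\<^esub>"
    using f_smult[of "\<zero>\<^bsub>M\<^esub>" 0] f_closed[of "\<zero>\<^bsub>M\<^esub>"] by simp
  have decompose: "(h, x) = (f x, x) \<oplus>\<^bsub>?G\<^esub> (h \<ominus>\<^bsub>H\<^esub> f x, \<zero>\<^bsub>M\<^esub>)"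
    if "h \<in> carrier H" "x \<in> carrier M" for h x
    using that f_closed[OF that(2)]
    by (simp add: semidirect_product_simps a_minus_def H.M.a_lcomm[of "f x"] H.M.r_neg)
  show "complementary ?G graph N"
    unfolding complementary_def
  proof (intro conjI)
    show "submodule graph real_scalars ?G"
    proof (rule G.submodule_if_closed)
      show "\<zero>\<^bsub>?G\<^esub> \<in> graph"
        using imageI[of "\<zero>\<^bsub>M\<^esub>" "carrier M" "\<lambda>x. (f x, x)"]
        by (simp add: graph_def semidirect_product_simps f_zero)
    qed (auto simp: graph_def semidirect_product_simps f_closed f_add[symmetric] f_smult[symmetric])
    show "submodule N real_scalars ?G"
      by (rule G.submodule_if_closed) (auto simp: N_def semidirect_product_simps)
    show "graph \<inter> N = {\<zero>\<^bsub>?G\<^esub>}"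
      by (auto simp: graph_def N_def semidirect_product_simps f_zero image_iff)
    show "graph <+>\<^bsub>?G\<^esub> N = carrier ?G"
    proof
      show "graph <+>\<^bsub>?G\<^esub> N \<subseteq> carrier ?G"
        by (auto simp: graph_def N_def semidirect_product_simps set_add_def' f_closed)
      show "carrier ?G \<subseteq> graph <+>\<^bsub>?G\<^esub> N"
      proof
        fix u assume "u \<in> carrier ?G"
        then obtain h x where u: "u = (h, x)" "h \<in> carrier H" "x \<in> carrier M"
          by (auto simp: semidirect_product_simps)
        have "(f x, x) \<in> graph" "(h \<ominus>\<^bsub>H\<^esub> f x, \<zero>\<^bsub>M\<^esub>) \<in> N"
          using u f_closed by (auto simp: graph_def N_def)
        then show "u \<in> graph <+>\<^bsub>?G\<^esub> N"
          unfolding set_add_def' using decompose[OF u(2,3)] u(1) by blast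
      qed
    qed
  qed
  show "projection_along ?G graph N (h, x) = (f x, x)" if hx: "h \<in> carrier H" "x \<in> carrier M"
    unfolding projection_along_def
  proof (rule the_equality)
    have "(h \<ominus>\<^bsub>H\<^esub> f x, \<zero>\<^bsub>M\<^esub>) \<in> N" using hx f_closed by (auto simp: N_def)
    then show "(f x, x) \<in> graph \<and> (\<exists>n\<in>N. (h, x) = (f x, x) \<oplus>\<^bsub>?G\<^esub> n)"
      using decompose[OF hx] hx(2) by (auto simp: graph_def)
    show "s = (f x, x)" if "s \<in> graph \<and> (\<exists>n\<in>N. (h, x) = s \<oplus>\<^bsub>?G\<^esub> n)" for s
      using that by (auto simp: graph_def N_def semidirect_product_simps)
  qed
qed

section \<open>The enveloping Lie algebra of a Courant algebroid\<close>

context courant_algebroid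
begin

abbreviation leibniz_sections where
  "leibniz_sections \<equiv> courant_leibniz_algebra \<A> fib \<T> form br \<D>"

lemma leibniz_sections_simps:
  "carrier leibniz_sections = \<Gamma>"
  "x \<otimes>\<^bsub>leibniz_sections\<^esub> y = dorfman x y"
  "\<zero>\<^bsub>leibniz_sections\<^esub> = (\<lambda>p. 0)"
  "x \<oplus>\<^bsub>leibniz_sections\<^esub> y = (\<lambda>p. x p + y p)"
  "r \<odot>\<^bsub>leibniz_sections\<^esub> x = (\<lambda>p. r *\<^sub>R x p)"
  by (simp_all add: courant_leibniz_algebra_def dorfman_def)

lemma leibniz_sections_leibniz: "leibniz leibniz_sections"
proof -
  have neg: "\<exists>y\<in>\<Gamma>. (\<lambda>p. x p + y p) = (\<lambda>p. 0)" if "x \<in> \<Gamma>" for x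
    using section_scale[OF that, of "-1"] by (intro bexI[of _ "\<lambda>p. (-1) *\<^sub>R x p"]) simp_all
  have "nonassoc_algebra leibniz_sections"
    by (rule nonassoc_algebraI; unfold leibniz_sections_simps)
      (simp_all add: section_add section_zero section_scale dorfman_closed dorfman_add_left
        dorfman_add_right dorfman_scale_left dorfman_scale_right neg
        ac_simps scaleR_add_left scaleR_add_right)
  moreover have "leibniz_axioms leibniz_sections"
    by (rule leibniz_axioms.intro) (unfold leibniz_sections_simps, rule dorfman_leibniz)
  ultimately show ?thesis
    unfolding leibniz_def nonassoc_algebra_iff by (rule conjI)
qed

lemma smooth_zero: "(\<lambda>p. 0) \<in> smooth"
  by (simp add: smooth_functions_def smooth_fun_on_const)

lemma D_zero: "\<D> (\<lambda>p. 0) = (\<lambda>p. 0)"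
  using D_scale[OF smooth_zero, of 0] by simp

lemma D_image_two_sided_ideal: "two_sided_ideal (\<D> ` smooth) leibniz_sections"
proof -
  interpret leibniz leibniz_sections by (rule leibniz_sections_leibniz)
  have zero: "(\<lambda>p. 0) \<in> \<D> ` smooth"
    using imageI[OF smooth_zero, of \<D>] unfolding D_zero .
  have add: "(\<lambda>p. \<D> f p + \<D> g p) \<in> \<D> ` smooth" if "f \<in> smooth" "g \<in> smooth" for f g
    using imageI[OF smooth_functions_add[OF that], of \<D>] unfolding D_add[OF that] .
  have scale: "(\<lambda>p. r *\<^sub>R \<D> f p) \<in> \<D> ` smooth" if "f \<in> smooth" for f r
    using imageI[OF smooth_functions_scale[OF that], of \<D>] unfolding D_scale[OF that] .
  have "submodule (\<D> ` smooth) real_scalars leibniz_sections"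
    by (rule submodule_if_closed; unfold leibniz_sections_simps)
      (use zero add scale D_closed in \<open>blast+\<close>)
  moreover have "dorfman x i \<in> \<D> ` smooth \<and> dorfman i x \<in> \<D> ` smooth"
    if x: "x \<in> \<Gamma>" and i: "i \<in> \<D> ` smooth" for x i
  proof -
    obtain f where f: "f \<in> smooth" "i = \<D> f" using i by blast
    show ?thesis
      unfolding f(2) dorfman_D[OF x f(1)] dorfman_D_left[OF x f(1)]
      using zero act_smooth[OF f(1) x] by blast
  qed
  ultimately show ?thesis
    unfolding two_sided_ideal_def leibniz_sections_simps by blast
qed

lemma D_image_left_mult_kernel: "\<D> ` smooth \<subseteq> left_mult_kernel leibniz_sections"
  using D_closed dorfman_D_left
  by (auto simp: left_mult_kernel_def left_mult_def derivation_algebra_def leibniz_sections_simps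
      intro!: restrict_ext)

lemma squares_in_D_image: "x \<in> \<Gamma> \<Longrightarrow> dorfman x x \<in> \<D> ` smooth"
  using dorfman_self pair_smooth by blast

text \<open>
  The symmetric part of \<open>x \<cdot> y\<close> is \<open>\<D>\<langle>x, y\<rangle>\<close>, so its skew part is the Courant bracket.
\<close>

lemma br_eq_half_commutator:
  assumes "x \<in> \<Gamma>" "y \<in> \<Gamma>"
  shows "br x y = (\<lambda>p. (1/2) *\<^sub>R dorfman x y p + (-1) *\<^sub>R ((1/2) *\<^sub>R dorfman y x p))"
proof
  fix p
  have "pair y x = pair x y" using pair_sym[OF assms(2,1)] by blast
  moreover have "br y x p = - br x y p" using br_skew[OF assms(2,1)] by simp
  ultimately have "dorfman y x p = \<D> (pair x y) p - br x y p" by (simp add: dorfman_def)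
  moreover have "dorfman x y p = br x y p + \<D> (pair x y) p" by (simp add: dorfman_def)
  moreover have "br x y p = (1/2) *\<^sub>R br x y p + (1/2) *\<^sub>R br x y p"
    using scaleR_left_distrib[of "1/2" "1/2" "br x y p"] by simp
  ultimately show "br x y p = (1/2) *\<^sub>R dorfman x y p + (-1) *\<^sub>R ((1/2) *\<^sub>R dorfman y x p)"
    by (simp add: scaleR_add_right scaleR_diff_right)
qed

text \<open>
  The factor \<open>1/2\<close> is the one of the skew part: the second component of the bracket of the graph
  points over \<open>x\<close> and \<open>y\<close> is \<open>1/2 (x \<cdot> y - y \<cdot> x)\<close>.
\<close>

lemma half_graph_bracket:
  defines "E \<equiv> leibniz_sections"
  defines "H \<equiv> quotient_algebra E (\<D> ` smooth)"
    and "q \<equiv> coset_map E (\<D> ` smooth)"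
  defines "G \<equiv> semidirect_product H E (quotient_action E)"
    and "f \<equiv> \<lambda>x. (1/2) \<odot>\<^bsub>H\<^esub> q x"
  shows "linear_hom E H f"
    and "x \<in> \<Gamma> \<Longrightarrow> y \<in> \<Gamma> \<Longrightarrow> \<exists>h\<in>carrier H. (f x, x) \<otimes>\<^bsub>G\<^esub> (f y, y) = (h, br x y)"
proof -
  interpret E: leibniz E unfolding E_def by (rule leibniz_sections_leibniz)
  note E_simps = leibniz_sections_simps[folded E_def]
  have ideal: "two_sided_ideal (\<D> ` smooth) E"
    unfolding E_def by (rule D_image_two_sided_ideal)
  note ops = E.quotient_algebra_ops[OF ideal, folded H_def q_def, unfolded E_simps]
  have squares: "x \<otimes>\<^bsub>E\<^esub> x \<in> \<D> ` smooth" if "x \<in> carrier E" for x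
    using squares_in_D_image that by (simp add: E_simps)
  have kernel: "\<D> ` smooth \<subseteq> left_mult_kernel E"
    unfolding E_def by (rule D_image_left_mult_kernel)
  have act: "quotient_action E (q x) = left_mult E x" if "x \<in> \<Gamma>" for x
    unfolding q_def using E.quotient_action_coset_map[OF ideal squares kernel] that
    by (simp add: E_simps)
  interpret H: real_algebra H
    using E.quotient_lie_algebra[OF ideal squares kernel] unfolding H_def
    by (simp add: lie_algebra_def nonassoc_algebra_iff)
  have q_closed: "q x \<in> carrier H" if "x \<in> \<Gamma>" for x using ops(1) that by blast
  have f: "f x = q (\<lambda>p. (1/2) *\<^sub>R x p)" if "x \<in> \<Gamma>" for x
    unfolding f_def using ops(5)[OF that] by simp
  show "linear_hom E H f"
    unfolding linear_hom_def E_simps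
  proof (intro conjI ballI allI funcsetI)
    fix x assume x: "x \<in> \<Gamma>"
    show "f x \<in> carrier H" unfolding f_def by (intro H.real_smult_closed q_closed x)
    show "f (\<lambda>p. r *\<^sub>R x p) = r \<odot>\<^bsub>H\<^esub> f x" for r
      unfolding f[OF section_scale[OF x]] f[OF x] ops(5)[OF section_scale[OF x]]
      by (simp add: mult.commute)
    fix y assume y: "y \<in> \<Gamma>"
    show "f (\<lambda>p. x p + y p) = f x \<oplus>\<^bsub>H\<^esub> f y"
      unfolding f[OF section_add[OF x y]] f[OF x] f[OF y] ops(3)[OF section_scale[OF x] section_scale[OF y]]
      by (simp add: scaleR_add_right)
  qed
  show "\<exists>h\<in>carrier H. (f x, x) \<otimes>\<^bsub>G\<^esub> (f y, y) = (h, br x y)" if x: "x \<in> \<Gamma>" and y: "y \<in> \<Gamma>"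
  proof (rule bexI)
    have act_half: "quotient_action E (f x) y = (\<lambda>p. (1/2) *\<^sub>R dorfman x y p)"
      if "x \<in> \<Gamma>" "y \<in> \<Gamma>" for x y
      using that by (simp only: f act section_scale left_mult_def E_simps dorfman_scale_left restrict_apply if_True)
    have "quotient_action E (f x) y \<ominus>\<^bsub>E\<^esub> quotient_action E (f y) x = br x y"
      unfolding a_minus_def act_half[OF x y] act_half[OF y x]
      by (subst E.minus_eq_smult) (simp_all only: E_simps dorfman_closed section_scale x y br_eq_half_commutator)
    then show "(f x, x) \<otimes>\<^bsub>G\<^esub> (f y, y) = (f x \<otimes>\<^bsub>H\<^esub> f y, br x y)"
      unfolding G_def semidirect_product_simps by simp
    show "f x \<otimes>\<^bsub>H\<^esub> f y \<in> carrier H"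
      unfolding f_def by (intro H.mult_closed H.real_smult_closed q_closed x y)
  qed
qed

end

theorem mainTheorem5:
  fixes \<A> :: "('p::{t2_space, second_countable_topology}, 'm::real_inner) chart set"
    and fib :: "'p \<Rightarrow> 'e::real_vector set"
    and \<T> :: "('p, 'e, 'f::real_inner) trivialization set"
    and form :: "'p \<Rightarrow> 'e \<Rightarrow> 'e \<Rightarrow> real"
    and br :: "('p \<Rightarrow> 'e) \<Rightarrow> ('p \<Rightarrow> 'e) \<Rightarrow> ('p \<Rightarrow> 'e)"
    and \<rho> :: "'p \<Rightarrow> 'e \<Rightarrow> ('p, 'm) tangent_vector"
    and \<D> :: "('p \<Rightarrow> real) \<Rightarrow> ('p \<Rightarrow> 'e)"
    and E :: "(real, 'p \<Rightarrow> 'e) module"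
    and I :: "('p \<Rightarrow> 'e) set"
    and H :: "(real, ('p \<Rightarrow> 'e) set) module"
    and q :: "('p \<Rightarrow> 'e) \<Rightarrow> ('p \<Rightarrow> 'e) set"
    and act :: "('p \<Rightarrow> 'e) set \<Rightarrow> ('p \<Rightarrow> 'e) \<Rightarrow> ('p \<Rightarrow> 'e)"
    and G :: "(real, ('p \<Rightarrow> 'e) set \<times> ('p \<Rightarrow> 'e)) module"
    and graph :: "(('p \<Rightarrow> 'e) set \<times> ('p \<Rightarrow> 'e)) set"
    and N :: "(('p \<Rightarrow> 'e) set \<times> ('p \<Rightarrow> 'e)) set"
  assumes courant: "courant_algebroid \<A> fib \<T> form br \<rho> \<D>"
    and E: "E = courant_leibniz_algebra \<A> fib \<T> form br \<D>"
    and I: "I = \<D> ` smooth_functions \<A>"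
    and H: "H = quotient_algebra E I"
    and q: "q = coset_map E I"
    and act: "act = quotient_action E"
    and G: "G = semidirect_product H E act"
    and graph: "graph = (\<lambda>x. ((1/2) \<odot>\<^bsub>H\<^esub> q x, x)) ` carrier E"
    and N: "N = carrier H \<times> {\<zero>\<^bsub>E\<^esub>}"
  shows "leibniz_algebra E
    \<and> two_sided_ideal I E
    \<and> (\<forall>x\<in>carrier E. x \<otimes>\<^bsub>E\<^esub> x \<in> I)
    \<and> I \<subseteq> left_mult_kernel E
    \<and> lie_algebra H
    \<and> (\<forall>x\<in>carrier E. \<forall>y\<in>carrier E. q x \<otimes>\<^bsub>H\<^esub> q y = q (x \<otimes>\<^bsub>E\<^esub> y))
    \<and> (\<forall>x\<in>carrier E. act (q x) = left_mult E x)
    \<and> enveloping_lie_algebra G H act q E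
    \<and> subalgebra N G
    \<and> complementary G graph N
    \<and> (\<forall>x\<in>carrier E. \<forall>y\<in>carrier E.
         let u = ((1/2) \<odot>\<^bsub>H\<^esub> q x, x) \<otimes>\<^bsub>G\<^esub> ((1/2) \<odot>\<^bsub>H\<^esub> q y, y)
         in projection_along G graph N u = ((1/2) \<odot>\<^bsub>H\<^esub> q (br x y), br x y)
            \<and> snd u = br x y)"
proof -
  interpret C: courant_algebroid \<A> fib \<T> form br \<rho> \<D> by (rule courant)
  interpret E: leibniz E unfolding E by (rule C.leibniz_sections_leibniz)
  note E_simps = C.leibniz_sections_simps[folded E]
  have ideal: "two_sided_ideal I E"
    unfolding E I by (rule C.D_image_two_sided_ideal)
  have squares: "x \<otimes>\<^bsub>E\<^esub> x \<in> I" if "x \<in> carrier E" for x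
    using C.squares_in_D_image that by (simp add: E_simps I)
  have kernel: "I \<subseteq> left_mult_kernel E"
    unfolding E I by (rule C.D_image_left_mult_kernel)
  note ops = E.quotient_algebra_ops[OF ideal, folded H q]
  have lie: "lie_algebra H"
    unfolding H using E.quotient_lie_algebra[OF ideal squares kernel] .
  have action: "act (q x) = left_mult E x" if "x \<in> carrier E" for x
    unfolding act q using E.quotient_action_coset_map[OF ideal squares kernel that] .
  have env: "enveloping_lie_algebra G H act q E"
    using E.enveloping_quotient[OF ideal squares kernel] by (simp only: G H act q)
  have H_alg: "nonassoc_algebra H" using lie by (simp only: lie_algebra_def)
  have G_alg: "nonassoc_algebra (semidirect_product H E act)"
    using env by (simp only: enveloping_lie_algebra_def lie_algebra_def G)
  have E_alg: "nonassoc_algebra E"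
    by (simp only: nonassoc_algebra_iff E.real_algebra_axioms)
  have half: "linear_hom E H (\<lambda>x. (1/2) \<odot>\<^bsub>H\<^esub> q x)"
    using C.half_graph_bracket(1) unfolding H q E I .
  have bracket: "\<exists>h\<in>carrier H. ((1/2) \<odot>\<^bsub>H\<^esub> q x, x) \<otimes>\<^bsub>G\<^esub> ((1/2) \<odot>\<^bsub>H\<^esub> q y, y) = (h, br x y)"
    if "x \<in> carrier E" "y \<in> carrier E" for x y
    using C.half_graph_bracket(2)[of x y] that
    unfolding G H q act E I C.leibniz_sections_simps(1) by blast
  note compl = graph_complementary[OF H_alg E_alg half G_alg, folded graph N G]
  interpret H: real_algebra H using H_alg by (simp only: nonassoc_algebra_iff)
  have "subalgebra N G"
    unfolding subalgebra_def
  proof (intro conjI ballI)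
    show "submodule N real_scalars G" using compl(1) by (simp only: complementary_def)
    fix u v assume "u \<in> N" "v \<in> N"
    then obtain h k where hk: "h \<in> carrier H" "k \<in> carrier H" "u = (h, \<zero>\<^bsub>E\<^esub>)" "v = (k, \<zero>\<^bsub>E\<^esub>)"
      by (auto simp: N)
    have "act h \<zero>\<^bsub>E\<^esub> = \<zero>\<^bsub>E\<^esub>" if "h \<in> carrier H" for h
    proof -
      have "lie_hom H (derivation_algebra E) act" using env by (simp only: enveloping_lie_algebra_def)
      from lie_action_smult_right[OF this that, of "\<zero>\<^bsub>E\<^esub>" 0] lie_action_closed[OF this that, of "\<zero>\<^bsub>E\<^esub>"]
      show ?thesis by simp
    qed
    moreover have "h \<otimes>\<^bsub>H\<^esub> k \<in> carrier H" using hk by (intro H.mult_closed)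
    ultimately show "u \<otimes>\<^bsub>G\<^esub> v \<in> N"
      using hk by (simp add: G semidirect_product_simps N a_minus_def E.M.r_neg)
  qed
  moreover have "let u = ((1/2) \<odot>\<^bsub>H\<^esub> q x, x) \<otimes>\<^bsub>G\<^esub> ((1/2) \<odot>\<^bsub>H\<^esub> q y, y)
         in projection_along G graph N u = ((1/2) \<odot>\<^bsub>H\<^esub> q (br x y), br x y) \<and> snd u = br x y"
    if xy: "x \<in> carrier E" "y \<in> carrier E" for x y
  proof -
    obtain h where h: "h \<in> carrier H"
      "((1/2) \<odot>\<^bsub>H\<^esub> q x, x) \<otimes>\<^bsub>G\<^esub> ((1/2) \<odot>\<^bsub>H\<^esub> q y, y) = (h, br x y)"
      using bracket[OF xy] by blast
    have "br x y \<in> carrier E" using C.br_closed xy by (simp add: E_simps)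
    then show ?thesis unfolding h(2) Let_def using compl(2)[OF h(1)] by simp
  qed
  moreover have "leibniz_algebra E" by (simp only: leibniz_algebra_iff E.leibniz_axioms)
  ultimately show ?thesis
    using ideal squares kernel lie ops(4) action env compl(1) by (intro conjI ballI)
qed

end
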